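(* For every $a\in(1/2,1]$, $\mu_0^{\mathrm{even}}(2)>0$. Consequently, for every $a\in(1/2,1]$, $\mu_0^{\mathrm{even}}(k)>0$ for every integer $k$ with $|k|\ge2$.
   Context: For $a>1/2$ put $A(s)=\sqrt{a\cosh(2s)+\tfrac12}$, $B(s)=\sqrt{a\cosh(2s)-\tfrac12}$, $K=K(a)=\sqrt{a^2-\tfrac14}$, and $\varphi(s)=\int_0^s\frac{K}{A(t)^2B(t)}\,dt$. Let $s_0=s_0(a)>0$ be the unique positive solution of $\tanh\varphi(s_0)=\frac{B(s_0)K}{a\sinh(2s_0)}$, and let $r(a)>0$ be defined by $\cosh r(a)=A(s_0)\cosh\varphi(s_0)$. (These are the data of the critical spherical catenoid $\Sigma_a$ in the geodesic ball of radius $r(a)$ of $\mathbb{H}^3$, with $|\mathrm{II}|^2=2K^2/B^4$.) For $k\in\mathbb{Z}$ set $W_k(s)=2K^2/B(s)^4-2-k^2/B(s)^2$ and, for $u\in H^1((-s_0,s_0))$, $$\mathcal{S}_k^{\mathrm{rad}}(u,u)=\int_{-s_0}^{s_0}\bigl[B(u')^2-BW_ku^2\bigr]ds-\coth r(a)\,B(s_0)\bigl[u(s_0)^2+u(-s_0)^2\bigr].$$ $\mu_0^{\mathrm{even}}(k)$ is the lowest eigenvalue of $\mathcal{S}_k^{\mathrm{rad}}$ relative to the norm $\int_{-s_0}^{s_0}Bu^2ds$, restricted to functions even under $s\mapsto-s$. *)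

theory Defs
  imports "HOL-Analysis.Analysis"
begin

section \<open>The critical spherical catenoid\<close>

definition cat_A :: "real \<Rightarrow> real \<Rightarrow> real" where
  "cat_A a s = sqrt (a * cosh (2 * s) + 1 / 2)"

definition cat_B :: "real \<Rightarrow> real \<Rightarrow> real" where
  "cat_B a s = sqrt (a * cosh (2 * s) - 1 / 2)"

definition cat_K :: "real \<Rightarrow> real" where
  "cat_K a = sqrt (a\<^sup>2 - 1 / 4)"

definition cat_phi :: "real \<Rightarrow> real \<Rightarrow> real" where
  "cat_phi a s = (LBINT t=0..ereal s. cat_K a / ((cat_A a t)\<^sup>2 * cat_B a t))"

definition cat_s0 :: "real \<Rightarrow> real" where
  "cat_s0 a = (THE s. s > 0 \<and> tanh (cat_phi a s) = cat_B a s * cat_K a / (a * sinh (2 * s)))"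

definition cat_r :: "real \<Rightarrow> real" where
  "cat_r a = (THE r. r > 0 \<and> cosh r = cat_A a (cat_s0 a) * cosh (cat_phi a (cat_s0 a)))"

definition coth :: "real \<Rightarrow> real" where
  "coth x = cosh x / sinh x"

definition cat_W :: "real \<Rightarrow> int \<Rightarrow> real \<Rightarrow> real" where
  "cat_W a k s = 2 * (cat_K a)\<^sup>2 / (cat_B a s) ^ 4 - 2 - (real_of_int k)\<^sup>2 / (cat_B a s)\<^sup>2"


section \<open>The Sobolev space \<open>H\<^sup>1\<close> of a bounded open interval\<close>

definition L2 :: "real \<Rightarrow> real \<Rightarrow> (real \<Rightarrow> real) set" where
  "L2 l r = {f. set_borel_measurable lborel {l<..<r} f \<and>
                set_integrable lborel {l<..<r} (\<lambda>x. (f x)\<^sup>2)}"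

text \<open>
  Weak derivatives are taken against compactly supported test functions of class \<open>C\<^sup>1\<close>
  (as in Brezis' textbook); by mollification this agrees with smooth test functions.
\<close>

definition is_weak_deriv :: "real \<Rightarrow> real \<Rightarrow> (real \<Rightarrow> real) \<Rightarrow> (real \<Rightarrow> real) \<Rightarrow> bool" where
  "is_weak_deriv l r u v \<longleftrightarrow>
    (\<forall>\<psi> \<psi>'. (\<forall>x. (\<psi> has_real_derivative \<psi>' x) (at x)) \<and> continuous_on UNIV \<psi>' \<and>
            (\<exists>C. compact C \<and> C \<subseteq> {l<..<r} \<and> (\<forall>x. x \<notin> C \<longrightarrow> \<psi> x = 0)) \<longrightarrow>
       (LBINT x:{l<..<r}. u x * \<psi>' x) = - (LBINT x:{l<..<r}. v x * \<psi> x))"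

text \<open>
  An element of \<open>H\<^sup>1((l, r))\<close> is represented by its continuous representative on the
  closed interval, so that its boundary values are \<open>u l\<close> and \<open>u r\<close>.
  Values outside \<open>[l, r]\<close> are irrelevant.
\<close>

definition H1 :: "real \<Rightarrow> real \<Rightarrow> (real \<Rightarrow> real) set" where
  "H1 l r = {u. continuous_on {l..r} u \<and> u \<in> L2 l r \<and> (\<exists>v \<in> L2 l r. is_weak_deriv l r u v)}"

text \<open>Determined only up to a null set of \<open>(l, r)\<close>; it is used only under integrals.\<close>

definition weak_deriv :: "real \<Rightarrow> real \<Rightarrow> (real \<Rightarrow> real) \<Rightarrow> real \<Rightarrow> real" where
  "weak_deriv l r u = (SOME v. v \<in> L2 l r \<and> is_weak_deriv l r u v)"


section \<open>The radial form and its lowest even eigenvalue\<close>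

definition S_rad :: "real \<Rightarrow> int \<Rightarrow> (real \<Rightarrow> real) \<Rightarrow> (real \<Rightarrow> real) \<Rightarrow> real" where
  "S_rad a k u w =
    (let s0 = cat_s0 a; u' = weak_deriv (- s0) s0 u; w' = weak_deriv (- s0) s0 w in
      (LBINT s:{- s0<..<s0}. cat_B a s * (u' s * w' s) - cat_B a s * cat_W a k s * (u s * w s))
      - coth (cat_r a) * cat_B a s0 * (u s0 * w s0 + u (- s0) * w (- s0)))"

definition B_inner :: "real \<Rightarrow> (real \<Rightarrow> real) \<Rightarrow> (real \<Rightarrow> real) \<Rightarrow> real" where
  "B_inner a u w = (LBINT s:{- cat_s0 a<..<cat_s0 a}. cat_B a s * (u s * w s))"

definition H1_even :: "real \<Rightarrow> (real \<Rightarrow> real) set" where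
  "H1_even a = {u \<in> H1 (- cat_s0 a) (cat_s0 a). \<forall>s \<in> {- cat_s0 a..cat_s0 a}. u (- s) = u s}"

text \<open>Eigenvalues of the form relative to the weighted inner product, in the weak sense.\<close>

definition is_even_eigenvalue :: "real \<Rightarrow> int \<Rightarrow> real \<Rightarrow> bool" where
  "is_even_eigenvalue a k \<mu> \<longleftrightarrow>
    (\<exists>u \<in> H1_even a. (\<exists>s \<in> {- cat_s0 a<..<cat_s0 a}. u s \<noteq> 0) \<and>
       (\<forall>w \<in> H1_even a. S_rad a k u w = \<mu> * B_inner a u w))"

definition mu0_even :: "real \<Rightarrow> int \<Rightarrow> real" where
  "mu0_even a k = (LEAST \<mu>. is_even_eigenvalue a k \<mu>)"

end

theory Submission
  imports Defs
begin

text \<open>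
  Write \<open>b = B\<^sup>2 = a cosh (2 s) - 1/2\<close>. The function \<open>B\<close> is a positive even supersolution of the
  radial operator: a direct computation gives
    \<open>- (B B')' - B W\<^sub>k B = k\<^sup>2 - 1 - 2 K\<^sup>2 / b\<close>.
  Since \<open>K\<^sup>2 = (a - 1/2) (a + 1/2)\<close> and \<open>b \<ge> a - 1/2\<close>, the right-hand side is at least
  \<open>k\<^sup>2 - 2 - 2 a\<close>, which is nonnegative when \<open>\<bar>k\<bar> \<ge> 2\<close> and \<open>a \<le> 1\<close>, and it is positive for
  \<open>s \<noteq> 0\<close>. Moreover \<open>B\<close> satisfies the Robin boundary condition exactly: the equation for \<open>s\<^sub>0\<close> and the
  definition of \<open>r\<close> give \<open>coth r = B' / B\<close> at \<open>s\<^sub>0\<close> (lemma \<open>coth_r\<close>). Geometrically, \<open>B cos \<theta>\<close> is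
  a linear coordinate of the hyperboloid, whose radial logarithmic derivative on a sphere of radius
  \<open>r\<close> is \<open>coth r\<close>, and the catenoid meets that sphere orthogonally.

  Hence \<open>u = B v\<close> turns the quadratic form into \<open>\<integral> B\<^sup>3 v'\<^sup>2 + P v\<^sup>2\<close> with
  \<open>P = B (k\<^sup>2 - 1 - 2 K\<^sup>2 / b) \<ge> 0\<close> and without boundary terms, that is, into a Neumann problem with
  nonnegative potential, relative to the weight \<open>B\<^sup>3\<close>.

  The number \<open>mu0_even a k\<close> is a least element of the set of eigenvalues, so a lowest eigenvalue has
  to be produced. Shooting from the left endpoint gives a positive Neumann solution \<open>V\<close> for some
  \<open>\<mu> > 0\<close> (lemma \<open>neumann_ground_state\<close>); as the coefficients are even, \<open>V (s) + V (- s)\<close> is another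
  one, and \<open>\<Phi> = B (V (s) + V (- s))\<close> is a positive even solution of the Robin problem for \<open>\<mu>\<close>. The
  Picone identity
    \<open>S\<^sub>k(w, w) - \<mu> \<integral> B w\<^sup>2 = \<integral> B (w' - (\<Phi>' / \<Phi>) w)\<^sup>2\<close>
  for even \<open>w\<close> in \<open>H\<^sup>1\<close> then shows that no eigenvalue lies below \<open>\<mu>\<close>, so that the lowest one is
  \<open>\<mu> > 0\<close>. To integrate by parts with \<open>w\<close> in \<open>H\<^sup>1\<close>, weak derivatives are shown to be the same as
  square-integrable functions of which \<open>w\<close> is a primitive.
\<close>

section \<open>Primitives of integrable functions\<close>

text \<open>
  Absolute continuity on \<open>[l, r]\<close> together with a choice of the derivative.
\<close>
definition primitive_on :: "real \<Rightarrow> real \<Rightarrow> (real \<Rightarrow> real) \<Rightarrow> (real \<Rightarrow> real) \<Rightarrow> bool" where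
  "primitive_on l r u v \<longleftrightarrow> set_integrable lborel {l<..<r} v \<and>
     (\<forall>x\<in>{l..r}. u x - u l = (LBINT t:{l<..<x}. v t))"

lemma primitive_on_eq: "primitive_on l r u v \<Longrightarrow> l \<le> x \<Longrightarrow> x \<le> r \<Longrightarrow> u x = u l + (LBINT t:{l<..<x}. v t)"
  unfolding primitive_on_def by (metis atLeastAtMost_iff add_diff_cancel_left' diff_add_cancel)

lemma primitive_on_integrable_sub:
  assumes "primitive_on l r u v" "x \<le> r" "l \<le> y"
  shows "set_integrable lborel {y<..<x} v"
  by (rule set_integrable_subset[of _ "{l<..<r}"]) (use assms in \<open>auto simp: primitive_on_def\<close>)

lemma primitive_on_restrict:
  assumes "primitive_on l r u v" "x \<le> r"
  shows "primitive_on l x u v"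
  unfolding primitive_on_def
proof (intro conjI ballI)
  show "set_integrable lborel {l<..<x} v" by (rule primitive_on_integrable_sub[OF assms order_refl])
  fix y assume "y \<in> {l..x}"
  then show "u y - u l = (LBINT t:{l<..<y}. v t)"
    using primitive_on_eq[OF assms(1), of y] assms(2) by simp
qed

lemma primitive_on_diff:
  assumes "primitive_on l r u v" "l \<le> x" "x \<le> y" "y \<le> r"
  shows "u y - u x = (LBINT t:{x<..<y}. v t)"
proof -
  have i: "set_integrable lborel {l<..<y} v" "set_integrable lborel {l<..<x} v"
    "set_integrable lborel {x<..<y} v"
    using assms by (auto intro!: primitive_on_integrable_sub[OF assms(1)])
  have "(LBINT t=ereal l..ereal x. v t) + (LBINT t=ereal x..ereal y. v t) = (LBINT t=ereal l..ereal y. v t)"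
    by (rule interval_integral_sum) (use assms i in \<open>auto simp: interval_lebesgue_integrable_def min_def max_def\<close>)
  then have "(LBINT t:{l<..<x}. v t) + (LBINT t:{x<..<y}. v t) = (LBINT t:{l<..<y}. v t)"
    using assms by (simp add: interval_lebesgue_integral_le_eq)
  moreover have "u y = u l + (LBINT t:{l<..<y}. v t)" "u x = u l + (LBINT t:{l<..<x}. v t)"
    using assms by (auto intro!: primitive_on_eq)
  ultimately show ?thesis by simp
qed


lemma set_integrable_Icc_iff_Ioo:
  fixes f :: "real \<Rightarrow> real"
  shows "set_integrable lborel {l<..<r} f \<longleftrightarrow> set_integrable lborel {l..r} f"
  unfolding set_integrable_def
  by (rule integrable_discrete_difference[where X="{l,r}"]) (auto simp: indicator_def)

lemma primitive_on_continuous: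
  assumes "primitive_on l r u v"
  shows "continuous_on {l..r} u"
proof -
  have i: "set_integrable lborel {l<..<r} v" using assms by (simp add: primitive_on_def)
  have io: "v integrable_on {l<..<r}"
    using set_borel_integral_eq_integral(1)[OF i] .
  then have "v integrable_on {l..r}"
    by (simp add: integrable_on_open_interval_real)
  then have "continuous_on {l..r} (\<lambda>x. u l + integral {l..x} v)"
    by (intro continuous_intros indefinite_integral_continuous_1)
  moreover have "u x = u l + integral {l..x} v" if "x \<in> {l..r}" for x
    using primitive_on_eq[OF assms, of x] that
      set_borel_integral_eq_integral(2)[OF primitive_on_integrable_sub[OF assms, of x l]]
    by (simp add: integral_open_interval_real)
  ultimately show ?thesis
    by (metis (no_types, lifting) continuous_on_cong)
qed


lemma set_integrable_continuous_mult:
  fixes g v :: "real \<Rightarrow> real"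
  assumes g: "continuous_on {l..r} g" and v: "set_integrable lborel {l<..<r} v"
  shows "set_integrable lborel {l<..<r} (\<lambda>x. g x * v x)"
proof -
  obtain C where C: "\<And>x. x \<in> {l..r} \<Longrightarrow> \<bar>g x\<bar> \<le> C"
    using compact_imp_bounded[OF compact_continuous_image[OF g compact_Icc]]
    unfolding bounded_iff by fastforce
  have [measurable]: "(\<lambda>x. indicator {l<..<r} x * g x) \<in> borel_measurable borel"
    using borel_measurable_continuous_on_indicator[OF _ continuous_on_subset[OF g], of "{l<..<r}"]
    by (simp add: greaterThanLessThan_subseteq_atLeastAtMost_iff)
  have vi: "integrable lborel (\<lambda>x. indicator {l<..<r} x * v x)"
    using v by (simp add: set_integrable_def)
  have [measurable]: "(\<lambda>x. indicator {l<..<r} x * v x) \<in> borel_measurable borel"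
    using borel_measurable_integrable[OF vi] by simp
  have eq: "indicator {l<..<r} x *\<^sub>R (g x * v x)
     = (indicator {l<..<r} x * g x) * (indicator {l<..<r} x * v x)" for x
    by (auto simp: indicator_def)
  show ?thesis
    unfolding set_integrable_def eq
  proof (rule Bochner_Integration.integrable_bound)
    show "integrable lborel (\<lambda>x. C * (indicator {l<..<r} x * v x))"
      by (intro integrable_mult_right vi)
    show "AE x in lborel. norm (indicator {l<..<r} x * g x * (indicator {l<..<r} x * v x))
        \<le> norm (C * (indicator {l<..<r} x * v x))"
    proof (rule AE_I2)
      fix x show "norm (indicator {l<..<r} x * g x * (indicator {l<..<r} x * v x))
        \<le> norm (C * (indicator {l<..<r} x * v x))"
        using C[of x] by (auto simp: indicator_def abs_mult intro!: mult_right_mono)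
    qed
  qed simp
qed

text \<open>
  Integration by parts. It is Fubini's theorem for \<open>v t * z x\<close> on the triangle \<open>l < t < x < r\<close>: one order
  of integration produces \<open>\<integral> z (u - u l)\<close>, the other one \<open>\<integral> v (w r - w)\<close>.
\<close>
lemma primitive_on_mult_endpoints:
  assumes u: "primitive_on l r u v" and w: "primitive_on l r w z" and lr: "l \<le> r"
  shows "u r * w r - u l * w l = (LBINT x:{l<..<r}. u x * z x + v x * w x)"
proof -
  let ?I = "\<lambda>x. indicator {l<..<r} x :: real"
  define f where "f x = ?I x * v x" for x
  define h where "h x = ?I x * z x" for x
  have f: "integrable lborel f" and h: "integrable lborel h"
    using u w by (auto simp: primitive_on_def set_integrable_def f_def[abs_def] h_def[abs_def])
  have [measurable]: "f \<in> borel_measurable borel" "h \<in> borel_measurable borel"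
    using borel_measurable_integrable[OF f] borel_measurable_integrable[OF h] by auto
  define F where "F t x = (if t < x then f t * h x else 0)" for t x
  have Fm: "case_prod F \<in> borel_measurable (lborel \<Otimes>\<^sub>M lborel)"
    unfolding F_def by measurable
  have prod: "integrable (lborel \<Otimes>\<^sub>M lborel) (\<lambda>(t, x). f t * h x)"
  proof (rule lborel_pair.Fubini_integrable)
    show "integrable lborel (\<lambda>t. LBINT x. norm (case (t, x) of (t, x) \<Rightarrow> f t * h x))"
      using f h by (simp add: abs_mult)
    show "AE t in lborel. integrable lborel (\<lambda>x. case (t, x) of (t, x) \<Rightarrow> f t * h x)"
      using h by simp
  qed measurable
  have Fi: "integrable (lborel \<Otimes>\<^sub>M lborel) (case_prod F)"
    by (rule Bochner_Integration.integrable_bound[OF prod Fm]) (auto simp: F_def)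
  have 1: "(LBINT t. F t x) = h x * (u x - u l)" for x
  proof (cases "x \<in> {l<..<r}")
    case True
    have "(LBINT t. F t x) = (LBINT t. h x * (indicator {l<..<x} t *\<^sub>R v t))"
      using True by (intro Bochner_Integration.integral_cong) (auto simp: F_def f_def indicator_def)
    also have "\<dots> = h x * (LBINT t:{l<..<x}. v t)"
      by (simp add: set_lebesgue_integral_def)
    finally show ?thesis using primitive_on_eq[OF u, of x] True by simp
  qed (auto simp: F_def h_def cong: if_cong)
  have 2: "(LBINT x. F t x) = f t * (w r - w t)" for t
  proof (cases "t \<in> {l<..<r}")
    case True
    have "(LBINT x. F t x) = (LBINT x. f t * (indicator {t<..<r} x *\<^sub>R z x))"
      using True by (intro Bochner_Integration.integral_cong) (auto simp: F_def h_def indicator_def)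
    also have "\<dots> = f t * (LBINT x:{t<..<r}. z x)"
      by (simp add: set_lebesgue_integral_def)
    finally show ?thesis using primitive_on_diff[OF w, of t r] True by simp
  qed (auto simp: F_def f_def cong: if_cong)
  have iu: "set_integrable lborel {l<..<r} (\<lambda>x. u x * z x)"
    using set_integrable_continuous_mult[OF primitive_on_continuous[OF u]] w by (simp add: primitive_on_def)
  have iw: "set_integrable lborel {l<..<r} (\<lambda>x. w x * v x)"
    using set_integrable_continuous_mult[OF primitive_on_continuous[OF w]] u by (simp add: primitive_on_def)
  have iz: "set_integrable lborel {l<..<r} z" and iv: "set_integrable lborel {l<..<r} v"
    using u w by (auto simp: primitive_on_def)
  have "(LBINT x. h x * (u x - u l)) = (LBINT t. f t * (w r - w t))"
    using lborel_pair.Fubini_integral[OF Fi] unfolding 1 2 .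
  moreover have "(LBINT x. h x * (u x - u l)) = (LBINT x:{l<..<r}. u x * z x - u l * z x)"
    unfolding set_lebesgue_integral_def
    by (intro Bochner_Integration.integral_cong) (auto simp: h_def algebra_simps)
  moreover have "(LBINT t. f t * (w r - w t)) = (LBINT x:{l<..<r}. w r * v x - w x * v x)"
    unfolding set_lebesgue_integral_def
    by (intro Bochner_Integration.integral_cong) (auto simp: f_def algebra_simps)
  moreover have "(LBINT x:{l<..<r}. u x * z x - u l * z x) = (LBINT x:{l<..<r}. u x * z x) - u l * (LBINT x:{l<..<r}. z x)"
    using iu iz by simp
  moreover have "(LBINT x:{l<..<r}. w r * v x - w x * v x) = w r * (LBINT x:{l<..<r}. v x) - (LBINT x:{l<..<r}. w x * v x)"
    using iw iv by simp
  moreover have "(LBINT x:{l<..<r}. v x) = u r - u l" "(LBINT x:{l<..<r}. z x) = w r - w l"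
    using primitive_on_diff[OF u, of l r] primitive_on_diff[OF w, of l r] lr by auto
  moreover have "(LBINT x:{l<..<r}. u x * z x + v x * w x) = (LBINT x:{l<..<r}. u x * z x) + (LBINT x:{l<..<r}. w x * v x)"
    using set_integral_add(2)[OF iu iw] by (simp add: mult.commute[of "v _"])
  ultimately show ?thesis by (simp add: algebra_simps)
qed

lemma primitive_on_mult:
  assumes u: "primitive_on l r u v" and w: "primitive_on l r w z"
  shows "primitive_on l r (\<lambda>x. u x * w x) (\<lambda>x. u x * z x + v x * w x)"
  unfolding primitive_on_def
proof (intro conjI ballI)
  have iu: "set_integrable lborel {l<..<r} (\<lambda>x. u x * z x)"
    using set_integrable_continuous_mult[OF primitive_on_continuous[OF u]] w by (simp add: primitive_on_def)
  have iw: "set_integrable lborel {l<..<r} (\<lambda>x. w x * v x)"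
    using set_integrable_continuous_mult[OF primitive_on_continuous[OF w]] u by (simp add: primitive_on_def)
  show "set_integrable lborel {l<..<r} (\<lambda>x. u x * z x + v x * w x)"
    using set_integral_add(1)[OF iu iw] by (simp add: mult.commute[of "v _"])
next
  fix x assume x: "x \<in> {l..r}"
  then show "u x * w x - u l * w l = (LBINT t:{l<..<x}. u t * z t + v t * w t)"
    using x by (intro primitive_on_mult_endpoints primitive_on_restrict[OF u] primitive_on_restrict[OF w]) auto
qed

lemma primitive_on_C1:
  assumes f: "continuous_on {l..r} f'"
    and d: "\<And>x. x \<in> {l..r} \<Longrightarrow> (f has_real_derivative f' x) (at x within {l..r})"
  shows "primitive_on l r f f'"
  unfolding primitive_on_def
proof (intro conjI ballI)
  show "set_integrable lborel {l<..<r} f'"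
    unfolding set_integrable_Icc_iff_Ioo by (rule borel_integrable_atLeastAtMost'[OF f])
next
  fix x assume x: "x \<in> {l..r}"
  have "(LBINT t=ereal l..ereal x. f' t) = f x - f l"
  proof (rule interval_integral_FTC_finite)
    show "continuous_on {min l x..max l x} f'"
      using x by (intro continuous_on_subset[OF f]) auto
    fix y assume "min l x \<le> y" "y \<le> max l x"
    then show "(f has_vector_derivative f' y) (at y within {min l x..max l x})"
      using x d[of y] by (auto simp: has_real_derivative_iff_has_vector_derivative[symmetric]
        intro: DERIV_subset)
  qed
  then show "f x - f l = (LBINT t:{l<..<x}. f' t)"
    using x by (simp add: interval_lebesgue_integral_le_eq)
qed

lemma set_integral_continuous_Ioo:
  fixes f :: "real \<Rightarrow> real"
  assumes "continuous_on {l..r} f"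
  shows "set_integrable lborel {l<..<r} f"
    and "(LBINT x:{l<..<r}. f x) = integral {l..r} f"
proof -
  show i: "set_integrable lborel {l<..<r} f"
    unfolding set_integrable_Icc_iff_Ioo by (rule borel_integrable_atLeastAtMost'[OF assms])
  show "(LBINT x:{l<..<r}. f x) = integral {l..r} f"
    using set_borel_integral_eq_integral(2)[OF i] by (simp add: integral_open_interval_real)
qed


section \<open>Weak derivatives on an interval\<close>

text \<open>
  From \<open>\<bar>f g\<bar> \<le> f\<^sup>2 + g\<^sup>2\<close>; with \<open>g = 1\<close> it yields that square-integrable functions are integrable on
  bounded intervals.
\<close>
lemma L2_mult_integrable:
  assumes "f \<in> L2 l r" "g \<in> L2 l r"
  shows "set_integrable lborel {l<..<r} (\<lambda>x. f x * g x)"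
proof -
  let ?I = "\<lambda>x. indicator {l<..<r} x :: real"
  have [measurable]: "(\<lambda>x. ?I x * f x) \<in> borel_measurable borel" "(\<lambda>x. ?I x * g x) \<in> borel_measurable borel"
    using assms by (auto simp: L2_def set_borel_measurable_def)
  have eq: "?I x *\<^sub>R (f x * g x) = (?I x * f x) * (?I x * g x)" for x
    by (auto simp: indicator_def)
  have i: "integrable lborel (\<lambda>x. ?I x *\<^sub>R ((f x)\<^sup>2) + ?I x *\<^sub>R ((g x)\<^sup>2))"
    using assms by (intro Bochner_Integration.integrable_add) (auto simp: L2_def set_integrable_def)
  show ?thesis
    unfolding set_integrable_def eq
  proof (rule Bochner_Integration.integrable_bound[OF i])
    have "\<bar>f x * g x\<bar> \<le> (f x)\<^sup>2 + (g x)\<^sup>2" for x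
    proof -
      have "2 * \<bar>f x\<bar> * \<bar>g x\<bar> \<le> (f x)\<^sup>2 + (g x)\<^sup>2"
        using sum_squares_bound[of "\<bar>f x\<bar>" "\<bar>g x\<bar>"] by simp
      moreover have "0 \<le> \<bar>f x\<bar> * \<bar>g x\<bar>" by simp
      ultimately show ?thesis unfolding abs_mult by linarith
    qed
    then show "AE x in lborel. norm (?I x * f x * (?I x * g x))
      \<le> norm (?I x *\<^sub>R ((f x)\<^sup>2) + ?I x *\<^sub>R ((g x)\<^sup>2))"
      by (intro AE_I2) (auto simp: indicator_def)
  qed simp
qed

lemma L2_continuous:
  assumes "continuous_on {l..r} f"
  shows "f \<in> L2 l r"
proof -
  have "set_borel_measurable lborel {l<..<r} f"
    using set_integral_continuous_Ioo(1)[OF assms]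
    by (auto simp: set_integrable_def set_borel_measurable_def dest: borel_measurable_integrable)
  then show ?thesis
    unfolding L2_def using assms by (auto intro!: set_integral_continuous_Ioo(1) continuous_intros)
qed

lemma L2_integrable:
  assumes "f \<in> L2 l r"
  shows "set_integrable lborel {l<..<r} f"
  using L2_mult_integrable[OF assms L2_continuous[of l r "\<lambda>_. 1"]] by simp

lemma test_function_primitive_on:
  fixes \<psi> \<psi>' :: "real \<Rightarrow> real"
  assumes "\<And>x. (\<psi> has_real_derivative \<psi>' x) (at x)" "continuous_on UNIV \<psi>'"
  shows "primitive_on l r \<psi> \<psi>'"
  by (rule primitive_on_C1) (use assms in \<open>auto intro: continuous_on_subset DERIV_subset\<close>)

lemma primitive_on_imp_weak_deriv:
  assumes u: "primitive_on l r u v" and lr: "l \<le> r"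
  shows "is_weak_deriv l r u v"
  unfolding is_weak_deriv_def
proof (intro allI impI, elim conjE exE)
  fix \<psi> \<psi>' :: "real \<Rightarrow> real" and C
  assume d: "\<forall>x. (\<psi> has_real_derivative \<psi>' x) (at x)" and c: "continuous_on UNIV \<psi>'"
    and C: "C \<subseteq> {l<..<r}" "\<forall>x. x \<notin> C \<longrightarrow> \<psi> x = 0"
  have p: "primitive_on l r \<psi> \<psi>'"
    by (rule test_function_primitive_on) (use d c in auto)
  have "\<psi> l = 0" "\<psi> r = 0" using C by force+
  then have "0 = (LBINT x:{l<..<r}. u x * \<psi>' x + v x * \<psi> x)"
    using primitive_on_mult_endpoints[OF u p lr] by simp
  moreover have i1: "set_integrable lborel {l<..<r} (\<lambda>x. u x * \<psi>' x)"
    using p by (intro set_integrable_continuous_mult primitive_on_continuous[OF u]) (simp add: primitive_on_def)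
  moreover have "set_integrable lborel {l<..<r} (\<lambda>x. v x * \<psi> x)"
    using set_integrable_continuous_mult[OF primitive_on_continuous[OF p], of v] u
    by (simp add: primitive_on_def mult.commute)
  ultimately show "(LBINT x:{l<..<r}. u x * \<psi>' x) = - (LBINT x:{l<..<r}. v x * \<psi> x)"
    by simp
qed

lemma continuous_antiderivative:
  fixes g :: "real \<Rightarrow> real"
  assumes "continuous_on UNIV g"
  obtains G where "\<And>x. (G has_real_derivative g x) (at x)"
proof -
  have "\<exists>F. \<forall>x :: real. -\<infinity> < ereal x \<longrightarrow> ereal x < \<infinity> \<longrightarrow> (F has_vector_derivative g x) (at x)"
    by (rule einterval_antiderivative) (use assms in \<open>auto simp: continuous_on_eq_continuous_at\<close>)
  then show ?thesis
    using that by (auto simp: has_real_derivative_iff_has_vector_derivative)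
qed

text \<open>
  The lemma of du Bois-Reymond for a continuous \<open>d\<close>. Let \<open>\<eta>\<close> be a nonnegative bump on \<open>(x1, y1)\<close> and
  \<open>c\<close> the mean of \<open>d\<close> for the weight \<open>\<eta>\<close>. Then \<open>(d - c) \<eta>\<close> has integral zero, so it is the derivative of a
  test function, and testing with it gives \<open>\<integral> (d - c)\<^sup>2 \<eta> = 0\<close>.
\<close>
lemma constant_if_orthogonal_to_derivatives:
  assumes d: "continuous_on {l..r} d" and lr: "l < r"
    and orth: "\<And>\<psi> \<psi>' C. (\<And>x. (\<psi> has_real_derivative \<psi>' x) (at x)) \<Longrightarrow> continuous_on UNIV \<psi>' \<Longrightarrow>
      compact C \<Longrightarrow> C \<subseteq> {l<..<r} \<Longrightarrow> (\<And>x. x \<notin> C \<Longrightarrow> \<psi> x = 0) \<Longrightarrow>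
      (LBINT x:{l<..<r}. d x * \<psi>' x) = 0"
    and x: "x \<in> {l..r}"
  shows "d x = d l"
proof -
  define D where "D s = d (max l (min r s))" for s
  have D: "continuous_on UNIV D"
    unfolding D_def using lr by (intro continuous_on_compose2[OF d]) (auto intro!: continuous_intros)
  have DD: "D s = d s" if "s \<in> {l..r}" for s using that by (auto simp: D_def)
  have inner: "\<exists>c. \<forall>s\<in>{x1<..<y1}. d s = c" if xy: "l < x1" "x1 < y1" "y1 < r" for x1 y1
  proof -
    define \<eta> where "\<eta> s = max 0 ((s - x1) * (y1 - s))" for s
    have \<eta>: "continuous_on S \<eta>" for S unfolding \<eta>_def by (intro continuous_intros)
    have \<eta>0: "\<eta> s = 0" if "s \<notin> {x1<..<y1}" for s
      using that xy by (auto simp: \<eta>_def mult_le_0_iff)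
    have \<eta>pos: "\<eta> s > 0" if "s \<in> {x1<..<y1}" for s
      using that by (auto simp: \<eta>_def)
    have \<eta>nn: "\<eta> s \<ge> 0" for s by (simp add: \<eta>_def)
    define c where "c = integral {x1..y1} (\<lambda>s. D s * \<eta> s) / integral {x1..y1} \<eta>"
    have "integral {x1..y1} \<eta> \<noteq> 0"
      using integral_eq_0_iff[OF \<eta> xy(2)] \<eta>nn \<eta>pos[of "(x1+y1)/2"] xy by force
    then have c: "integral {x1..y1} (\<lambda>s. D s * \<eta> s) = c * integral {x1..y1} \<eta>"
      by (simp add: c_def)
    define g where "g s = (D s - c) * \<eta> s" for s
    have g: "continuous_on UNIV g" unfolding g_def by (intro continuous_intros D \<eta>)
    obtain G where G: "\<And>x. (G has_real_derivative g x) (at x)"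
      using continuous_antiderivative[OF g] by blast
    define \<psi> where "\<psi> s = G s - G x1" for s
    have \<psi>: "(\<psi> has_real_derivative g s) (at s)" for s
      unfolding \<psi>_def by (auto intro!: derivative_eq_intros G)
    have gi: "integral {x..y} g = G y - G x" if "x \<le> y" for x y
      using that by (intro integral_unique fundamental_theorem_of_calculus)
        (auto simp: has_real_derivative_iff_has_vector_derivative[symmetric] intro: DERIV_subset[OF G])
    have ci: "(\<lambda>s. D s * \<eta> s) integrable_on {x1..y1}" "(\<lambda>s. c * \<eta> s) integrable_on {x1..y1}"
      by (intro integrable_continuous_real continuous_intros \<eta> continuous_on_subset[OF D]; simp)+
    have g1: "integral {x1..y1} g = 0"
      unfolding g_def left_diff_distrib
      using c by (simp add: Henstock_Kurzweil_Integration.integral_diff[OF ci])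
    have z: "integral {x..y} g = 0" if "y \<le> x1 \<or> y1 \<le> x" for x y
    proof -
      have "integral {x..y} g = integral {x..y} (\<lambda>_. 0)"
        using that by (intro integral_cong) (auto simp: g_def \<eta>0)
      then show ?thesis by simp
    qed
    have supp: "\<psi> s = 0" if "s \<notin> {x1..y1}" for s
    proof (cases "s < x1")
      case True
      then show ?thesis using z[of x1 s] gi[of s x1] by (simp add: \<psi>_def)
    next
      case False
      then have "y1 \<le> s" using that by auto
      then show ?thesis using z[of s y1] g1 gi[of y1 s] gi[of x1 y1] xy by (simp add: \<psi>_def)
    qed
    have "(LBINT s:{l<..<r}. d s * g s) = 0"
      by (rule orth[of \<psi> g "{x1..y1}"]) (use \<psi> g supp xy in auto)
    have cd: "continuous_on {l..r} (\<lambda>s. d s * g s)"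
      by (intro continuous_intros d continuous_on_subset[OF g]) auto
    have o: "integral {l..r} (\<lambda>s. d s * g s) = 0"
      using \<open>(LBINT s:{l<..<r}. d s * g s) = 0\<close> set_integral_continuous_Ioo(2)[OF cd] by simp
    have g2: "integral {l..r} g = 0"
      using gi[of l r] gi[of l x1] gi[of x1 y1] gi[of y1 r] z[of x1 l] z[of r y1] g1 xy by auto
    have i2: "(\<lambda>s. d s * g s) integrable_on {l..r}" "(\<lambda>s. c * g s) integrable_on {l..r}"
      by (intro integrable_continuous_real cd continuous_intros continuous_on_subset[OF g]; simp)+
    have "integral {l..r} (\<lambda>s. (d s - c) * g s) = 0"
      unfolding left_diff_distrib
      by (simp add: Henstock_Kurzweil_Integration.integral_diff[OF i2] o g2)
    moreover have "(d s - c) * g s \<ge> 0" if "s \<in> {l..r}" for s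
      using DD[OF that] \<eta>nn[of s] by (simp add: g_def mult.assoc[symmetric])
    moreover have "continuous_on {l..r} (\<lambda>s. (d s - c) * g s)"
      by (intro continuous_intros d continuous_on_subset[OF g]) auto
    ultimately have z0: "\<forall>s\<in>{l..r}. (d s - c) * g s = 0"
      using integral_eq_0_iff[of l r "\<lambda>s. (d s - c) * g s"] lr by auto
    have "d s = c" if s: "s \<in> {x1<..<y1}" for s
    proof -
      have "s \<in> {l..r}" using s xy by auto
      then show ?thesis using z0 \<eta>pos[OF s] DD[of s] by (force simp: g_def)
    qed
    then show ?thesis by blast
  qed
  define m where "m = (l + r) / 2"
  have inn: "d s = d m" if s: "s \<in> {l<..<r}" for s
  proof -
    define x1 where "x1 = (l + min s m) / 2"
    define y1 where "y1 = (r + max s m) / 2"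
    have m: "l < m" "m < r" using lr by (auto simp: m_def)
    then have a: "l < x1" "x1 < y1" "y1 < r" "s \<in> {x1<..<y1}" "m \<in> {x1<..<y1}"
      using s by (auto simp: x1_def y1_def)
    then show ?thesis using inner[OF a(1-3)] by metis
  qed
  have "d s = d m" if "s \<in> {l..r}" for s
    using continuous_constant_on_closure[of "{l<..<r}" d "d m" s] d inn that lr by auto
  from this[OF x] this[of l] show ?thesis using lr by simp
qed

text \<open>
  The primitive of \<open>v\<close> has weak derivative \<open>v\<close> too, hence differs from \<open>u\<close> by a constant.
\<close>
lemma weak_deriv_imp_primitive_on:
  assumes u: "continuous_on {l..r} u" and v: "set_integrable lborel {l<..<r} v"
    and w: "is_weak_deriv l r u v" and lr: "l < r"
  shows "primitive_on l r u v"
proof -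
  define U where "U x = (LBINT t:{l<..<x}. v t)" for x
  have U: "primitive_on l r U v"
    using v by (auto simp: primitive_on_def U_def set_lebesgue_integral_def)
  have Uw: "is_weak_deriv l r U v"
    using primitive_on_imp_weak_deriv[OF U] lr by simp
  have d: "continuous_on {l..r} (\<lambda>x. u x - U x)"
    by (intro continuous_intros u primitive_on_continuous[OF U])
  have const: "u x - U x = u l - U l" if "x \<in> {l..r}" for x
  proof (rule constant_if_orthogonal_to_derivatives[OF d lr _ that])
    fix \<psi> \<psi>' :: "real \<Rightarrow> real" and C
    assume \<psi>: "\<And>x. (\<psi> has_real_derivative \<psi>' x) (at x)" "continuous_on UNIV \<psi>'"
      "compact C" "C \<subseteq> {l<..<r}" "\<And>x. x \<notin> C \<Longrightarrow> \<psi> x = 0"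
    have "(LBINT x:{l<..<r}. u x * \<psi>' x) = - (LBINT x:{l<..<r}. v x * \<psi> x)"
      using w \<psi> unfolding is_weak_deriv_def by blast
    moreover have "(LBINT x:{l<..<r}. U x * \<psi>' x) = - (LBINT x:{l<..<r}. v x * \<psi> x)"
      using Uw \<psi> unfolding is_weak_deriv_def by blast
    moreover have "set_integrable lborel {l<..<r} (\<lambda>x. u x * \<psi>' x)" "set_integrable lborel {l<..<r} (\<lambda>x. U x * \<psi>' x)"
      by (intro set_integral_continuous_Ioo(1) continuous_intros u primitive_on_continuous[OF U] continuous_on_subset[OF \<psi>(2)]; simp)+
    ultimately show "(LBINT x:{l<..<r}. (u x - U x) * \<psi>' x) = 0"
      by (simp add: left_diff_distrib)
  qed
  have "U l = 0" by (simp add: U_def set_lebesgue_integral_def)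
  then show ?thesis
    unfolding primitive_on_def using v const by (force simp: U_def)
qed

lemma H1_weak_deriv:
  assumes "u \<in> H1 l r" "l < r"
  shows "weak_deriv l r u \<in> L2 l r" "primitive_on l r u (weak_deriv l r u)"
proof -
  have "\<exists>v. v \<in> L2 l r \<and> is_weak_deriv l r u v" using assms by (auto simp: H1_def)
  then have *: "weak_deriv l r u \<in> L2 l r \<and> is_weak_deriv l r u (weak_deriv l r u)"
    unfolding weak_deriv_def by (rule someI_ex)
  then show "weak_deriv l r u \<in> L2 l r" by simp
  show "primitive_on l r u (weak_deriv l r u)"
    using * assms by (intro weak_deriv_imp_primitive_on L2_integrable) (auto simp: H1_def)
qed

lemma primitive_on_H1:
  assumes "primitive_on l r u v" "v \<in> L2 l r" "l < r"
  shows "u \<in> H1 l r"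
  using assms primitive_on_imp_weak_deriv[OF assms(1)] primitive_on_continuous[OF assms(1)]
    L2_continuous[OF primitive_on_continuous[OF assms(1)]] by (auto simp: H1_def)

text \<open>
  Integrals over half-lines determine the integrals over all Borel sets, by a Dynkin system argument,
  and these determine an integrable function almost everywhere. This is needed because the weak
  derivative in the definition of the form is an arbitrary choice.
\<close>
lemma primitive_on_unique_AE:
  assumes v: "primitive_on l r u v" and w: "primitive_on l r u w" and lr: "l \<le> r"
  shows "AE x in lborel. indicator {l<..<r} x *\<^sub>R v x = indicator {l<..<r} x *\<^sub>R w x"
proof (rule density_unique_real)
  let ?I = "\<lambda>x. indicator {l<..<r} x :: real"
  show i: "integrable lborel (\<lambda>x. ?I x *\<^sub>R v x)" "integrable lborel (\<lambda>x. ?I x *\<^sub>R w x)"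
    using v w by (auto simp: primitive_on_def set_integrable_def)
  define e where "e x = ?I x *\<^sub>R v x - ?I x *\<^sub>R w x" for x
  have e: "integrable lborel e" unfolding e_def using i by auto
  have es: "set_integrable lborel A e" if "A \<in> sets borel" for A
    unfolding set_integrable_def using integrable_mult_indicator[OF _ e, of A] that by simp
  have half: "(LBINT x:{..<a}. e x) = 0" for a
  proof -
    have "(LBINT x:{..<a}. e x) = (LBINT x:{l<..<min a r}. v x - w x)"
      unfolding set_lebesgue_integral_def
      by (intro Bochner_Integration.integral_cong) (auto simp: e_def indicator_def)
    also have "\<dots> = (LBINT x:{l<..<min a r}. v x) - (LBINT x:{l<..<min a r}. w x)"
      by (intro set_integral_diff primitive_on_integrable_sub[OF v] primitive_on_integrable_sub[OF w]) auto
    also have "\<dots> = 0"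
    proof (cases "l \<le> min a r")
      case True
      then show ?thesis
        using primitive_on_diff[OF v, of l "min a r"] primitive_on_diff[OF w, of l "min a r"] by simp
    next
      case False
      then have "{l<..<min a r} = {}" by auto
      then show ?thesis by (simp add: set_lebesgue_integral_def)
    qed
    finally show ?thesis .
  qed
  have "(LBINT x. e x) = (LBINT x:{..<r}. e x)"
    unfolding set_lebesgue_integral_def
    by (intro Bochner_Integration.integral_cong) (auto simp: e_def indicator_def)
  then have tot: "(LBINT x. e x) = 0" using half by simp
  have borel: "sets borel = sigma_sets UNIV (range (\<lambda>a::real. {..<a}))"
    by (simp add: borel_eq_lessThan eucl_lessThan)
  have all: "(LBINT x:A. e x) = 0" if "A \<in> sigma_sets UNIV (range (\<lambda>a::real. {..<a}))" for A
    using _ _ that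
  proof (induct A rule: sigma_sets_induct_disjoint)
    show "Int_stable (range (\<lambda>a::real. {..<a}))"
      unfolding Int_stable_def
    proof clarify
      fix a b :: real
      show "{..<a} \<inter> {..<b} \<in> range lessThan"
        by (rule range_eqI[of _ _ "min a b"]) auto
    qed
  next
    fix A assume "A \<in> sigma_sets UNIV (range (\<lambda>a::real. {..<a}))" and z: "(LBINT x:A. e x) = 0"
    then have A: "A \<in> sets borel" by (simp add: borel)
    have "(LBINT x:UNIV - A. e x) = (LBINT x. e x - indicator A x *\<^sub>R e x)"
      unfolding set_lebesgue_integral_def
      by (intro Bochner_Integration.integral_cong) (auto simp: indicator_def)
    also have "\<dots> = (LBINT x. e x) - (LBINT x:A. e x)"
      unfolding set_lebesgue_integral_def
      using es[OF A] e by (intro Bochner_Integration.integral_diff) (auto simp: set_integrable_def)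
    finally show "(LBINT x:UNIV - A. e x) = 0" using z tot by simp
  next
    fix A :: "nat \<Rightarrow> real set"
    assume d: "disjoint_family A" and A: "range A \<subseteq> sigma_sets UNIV (range (\<lambda>a::real. {..<a}))"
      and z: "\<And>i. (LBINT x:A i. e x) = 0"
    have A': "A i \<in> sets borel" for i using A by (auto simp: borel)
    have "(LBINT x:(\<Union>i. A i). e x) = (\<Sum>i. (LBINT x:A i. e x))"
      by (rule lebesgue_integral_countable_add)
        (use d A' in \<open>auto intro!: es simp: disjoint_family_on_def\<close>)
    then show "(LBINT x:(\<Union>i. A i). e x) = 0" using z by simp
  qed (use half in \<open>auto simp: set_lebesgue_integral_def\<close>)
  fix A :: "real set" assume A: "A \<in> sets lborel"
  then have "(LBINT x:A. e x) = 0" using all by (simp add: borel)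
  moreover have "(LBINT x:A. e x) = (LBINT x:A. ?I x *\<^sub>R v x) - (LBINT x:A. ?I x *\<^sub>R w x)"
    unfolding e_def
    by (intro set_integral_diff; unfold set_integrable_def; intro integrable_mult_indicator A i)
  ultimately show "(LBINT x:A. ?I x *\<^sub>R v x) = (LBINT x:A. ?I x *\<^sub>R w x)" by simp
qed

section \<open>Lipschitz ordinary differential equations\<close>

text \<open>
  Picard iteration on the whole interval at once: after multiplication by the weight
  \<open>exp (- 2 C (s - l))\<close> the integral operator is a contraction with factor \<open>1/2\<close>, because
  \<open>\<integral> C exp (2 C (t - l))\<close> over \<open>[l, s]\<close> is at most half of \<open>exp (2 C (s - l))\<close>. The fixed point \<open>g\<close> is the solution
  times the weight, extended to the real line as a constant beyond the endpoints.
\<close>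
lemma exists_solution_Lipschitz_ode:
  fixes f :: "real \<Rightarrow> 'a::euclidean_space \<Rightarrow> 'a"
  assumes cont: "continuous_on ({l..r} \<times> UNIV) (\<lambda>(s, y). f s y)"
    and lip: "\<And>s y z. s \<in> {l..r} \<Longrightarrow> norm (f s y - f s z) \<le> C * norm (y - z)"
    and C: "C > 0" and lr: "l < r"
  obtains y where "y l = y0"
    and "\<And>s. s \<in> {l..r} \<Longrightarrow> (y has_vector_derivative f s (y s)) (at s within {l..r})"
proof -
  define k where "k = 2 * C"
  have k: "k > 0" using C by (simp add: k_def)
  define G where "G g t = f t (exp (k * (t - l)) *\<^sub>R apply_bcontfun g t)" for g :: "real \<Rightarrow>\<^sub>C 'a" and t
  have G: "continuous_on {l..r} (G g)" for g
  proof -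
    have "continuous_on {l..r} (\<lambda>t. (t, exp (k * (t - l)) *\<^sub>R apply_bcontfun g t))"
      by (intro continuous_intros continuous_on_apply_bcontfun)
    from continuous_on_compose2[OF cont this] show ?thesis
      by (auto simp: G_def[abs_def])
  qed
  have Gi: "G g integrable_on {a..b}" if "l \<le> a" "b \<le> r" for g a b
    using that by (intro integrable_continuous_real continuous_on_subset[OF G]) auto
  define T0 where "T0 g s = exp (- k * (s - l)) *\<^sub>R (y0 + integral {l..s} (G g))" for g s
  have T0: "continuous_on (cbox l r) (T0 g)" for g
    unfolding T0_def box_real
    by (intro continuous_intros indefinite_integral_continuous_1 Gi) auto
  have "\<forall>g. \<exists>h :: real \<Rightarrow>\<^sub>C 'a. \<forall>x. h x = T0 g (clamp l r x)"
    using continuous_on_cbox_bcontfunE[OF T0] by metis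
  then obtain T :: "(real \<Rightarrow>\<^sub>C 'a) \<Rightarrow> (real \<Rightarrow>\<^sub>C 'a)" where T: "\<And>g x. T g x = T0 g (clamp l r x)"
    by metis
  have cl: "clamp l r x \<in> {l..r}" for x :: real
    using clamp_in_interval[of l r x] lr by auto
  have cl': "clamp l r x = x" if "x \<in> {l..r}" for x :: real
    using clamp_cancel_cbox[of x l r] that by auto
  have step: "norm (T0 g s - T0 h s) \<le> 1 / 2 * dist g h" if s: "s \<in> {l..r}" for g h s
  proof -
    have "T0 g s - T0 h s = exp (- k * (s - l)) *\<^sub>R (integral {l..s} (G g) - integral {l..s} (G h))"
      by (simp add: T0_def algebra_simps)
    also have "integral {l..s} (G g) - integral {l..s} (G h) = integral {l..s} (\<lambda>t. G g t - G h t)"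
      using s by (intro Henstock_Kurzweil_Integration.integral_diff[symmetric] Gi) auto
    finally have n: "norm (T0 g s - T0 h s) = exp (- k * (s - l)) * norm (integral {l..s} (\<lambda>t. G g t - G h t))"
      by simp
    have e: "((\<lambda>t. C * dist g h * exp (k * (t - l))) has_integral
        (C * dist g h * (exp (k * (s - l)) / k) - C * dist g h * (exp (k * (l - l)) / k))) {l..s}"
      using s k by (intro fundamental_theorem_of_calculus)
        (auto simp: has_real_derivative_iff_has_vector_derivative[symmetric] intro!: derivative_eq_intros)
    have "norm (integral {l..s} (\<lambda>t. G g t - G h t)) \<le> integral {l..s} (\<lambda>t. C * dist g h * exp (k * (t - l)))"
    proof (rule integral_norm_bound_integral)
      show "(\<lambda>t. G g t - G h t) integrable_on {l..s}"
        using s by (intro integrable_diff Gi) auto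
      show "(\<lambda>t. C * dist g h * exp (k * (t - l))) integrable_on {l..s}" using e by blast
      fix t assume t: "t \<in> {l..s}"
      have "norm (G g t - G h t) \<le> C * norm (exp (k * (t - l)) *\<^sub>R g t - exp (k * (t - l)) *\<^sub>R h t)"
        unfolding G_def using t s by (intro lip) auto
      also have "\<dots> = C * (exp (k * (t - l)) * dist (g t) (h t))"
        by (simp add: scaleR_diff_right[symmetric] dist_norm)
      also have "\<dots> \<le> C * (exp (k * (t - l)) * dist g h)"
        using C by (intro mult_left_mono dist_bounded) auto
      finally show "norm (G g t - G h t) \<le> C * dist g h * exp (k * (t - l))" by (simp add: mult_ac)
    qed
    also have "\<dots> = C * dist g h * (exp (k * (s - l)) - 1) / k"
      using integral_unique[OF e] by (simp add: algebra_simps diff_divide_distrib)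
    also have "\<dots> \<le> C * dist g h * exp (k * (s - l)) / k"
      using C k by (intro divide_right_mono mult_left_mono) auto
    finally have "norm (T0 g s - T0 h s) \<le> exp (- k * (s - l)) * (C * dist g h * exp (k * (s - l)) / k)"
      unfolding n by (intro mult_left_mono) auto
    also have "\<dots> = (exp (- k * (s - l)) * exp (k * (s - l))) * (C / k) * dist g h" by simp
    also have "exp (- k * (s - l)) * exp (k * (s - l)) = 1" by (simp add: exp_add[symmetric])
    finally show ?thesis using C by (simp add: k_def)
  qed
  have "\<exists>!g. T g = g"
  proof (rule banach_fix_type[of "1/2"])
    show "\<forall>g h. dist (T g) (T h) \<le> 1 / 2 * dist g h"
      by (intro allI dist_bound) (simp add: T dist_norm[of "T0 _ _"] step[OF cl] del: times_divide_eq_left)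
  qed auto
  then obtain g where g: "T g = g" by blast
  have gs: "g s = T0 g s" if "s \<in> {l..r}" for s
    using T[of g s] cl'[OF that] g by simp
  define y where "y s = y0 + integral {l..s} (G g)" for s
  have yg: "exp (k * (s - l)) *\<^sub>R g s = y s" if "s \<in> {l..r}" for s
    unfolding gs[OF that] T0_def y_def by (simp add: exp_add[symmetric])
  show ?thesis
  proof
    show "y l = y0" by (simp add: y_def)
    fix s assume s: "s \<in> {l..r}"
    have "((\<lambda>s. y0 + integral {l..s} (G g)) has_vector_derivative 0 + G g s) (at s within {l..r})"
      by (intro has_vector_derivative_add has_vector_derivative_const integral_has_vector_derivative G s)
    then show "(y has_vector_derivative f s (y s)) (at s within {l..r})"
      using yg[OF s] by (simp add: y_def[abs_def, symmetric] G_def)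
  qed
qed


section \<open>The lowest Neumann eigenvalue\<close>

text \<open>
  The Neumann problem for \<open>- (p V')' + P V = \<mu> p V\<close> on \<open>[l, r]\<close>. It is written as a first-order system for
  \<open>V\<close> and its flux \<open>Z = p V'\<close>, so that \<open>p\<close> only has to be continuous.
\<close>
locale sturm_liouville =
  fixes l r :: real and p P :: "real \<Rightarrow> real"
  assumes lr: "l < r"
    and p_cont: "continuous_on {l..r} p" and P_cont: "continuous_on {l..r} P"
    and p_pos: "\<And>s. s \<in> {l..r} \<Longrightarrow> p s > 0"
    and P_nonneg: "\<And>s. s \<in> {l..r} \<Longrightarrow> P s \<ge> 0"
    and P_nonzero: "\<exists>s\<in>{l..r}. P s > 0"
begin

definition sol :: "real \<Rightarrow> (real \<Rightarrow> real) \<Rightarrow> (real \<Rightarrow> real) \<Rightarrow> bool" where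
  "sol \<mu> V Z \<longleftrightarrow> (\<forall>s\<in>{l..r}. (V has_real_derivative Z s / p s) (at s within {l..r}) \<and>
      (Z has_real_derivative (P s - \<mu> * p s) * V s) (at s within {l..r}))"

lemma bounded_continuous:
  fixes g :: "real \<Rightarrow> real"
  assumes "continuous_on {l..r} g"
  obtains M where "M > 0" "\<And>s. s \<in> {l..r} \<Longrightarrow> \<bar>g s\<bar> \<le> M"
proof -
  obtain C where C: "\<forall>x\<in>{l..r}. \<bar>g x\<bar> \<le> C"
    using compact_imp_bounded[OF compact_continuous_image[OF assms compact_Icc]]
    unfolding bounded_iff by fastforce
  show ?thesis by (rule that[of "max C 1"]) (use C in \<open>auto simp: le_max_iff_disj\<close>)
qed

lemma sol_exists: "\<exists>V Z. sol \<mu> V Z \<and> V l = 1 \<and> Z l = 0"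
proof -
  have ip: "continuous_on {l..r} (\<lambda>s. 1 / p s)" and q: "continuous_on {l..r} (\<lambda>s. P s - \<mu> * p s)"
    using p_pos by (intro continuous_intros p_cont P_cont; force)+
  obtain M1 where M1: "M1 > 0" "\<And>s. s \<in> {l..r} \<Longrightarrow> \<bar>1 / p s\<bar> \<le> M1"
    using bounded_continuous[OF ip] by blast
  obtain M2 where M2: "M2 > 0" "\<And>s. s \<in> {l..r} \<Longrightarrow> \<bar>P s - \<mu> * p s\<bar> \<le> M2"
    using bounded_continuous[OF q] by blast
  define f :: "real \<Rightarrow> real \<times> real \<Rightarrow> real \<times> real"
    where "f s y = ((1 / p s) * snd y, (P s - \<mu> * p s) * fst y)" for s y
  have fc: "continuous_on ({l..r} \<times> UNIV) (\<lambda>(s, y). f s y)"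
    unfolding f_def split_beta
    by (intro continuous_intros continuous_on_compose2[OF ip] continuous_on_compose2[OF q]) auto
  have fl: "norm (f s y - f s z) \<le> (M1 + M2) * norm (y - z)" if s: "s \<in> {l..r}" for s y z
  proof -
    have n: "norm (fst (y - z)) \<le> norm (y - z)" "norm (snd (y - z)) \<le> norm (y - z)"
      by (metis norm_fst_le prod.collapse) (metis norm_snd_le prod.collapse)
    have "f s y - f s z = ((1 / p s) * snd (y - z), (P s - \<mu> * p s) * fst (y - z))"
      by (simp add: f_def algebra_simps diff_divide_distrib)
    then have "norm (f s y - f s z) \<le> norm ((1 / p s) * snd (y - z)) + norm ((P s - \<mu> * p s) * fst (y - z))"
      using norm_Pair_le by metis
    also have "\<dots> = \<bar>1 / p s\<bar> * norm (snd (y - z)) + \<bar>P s - \<mu> * p s\<bar> * norm (fst (y - z))"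
      by (simp add: abs_mult)
    also have "\<dots> \<le> M1 * norm (y - z) + M2 * norm (y - z)"
      using M1 M2 s by (intro add_mono mult_mono n) auto
    finally show ?thesis by (simp add: algebra_simps)
  qed
  obtain y where y0: "y l = (1, 0)" and y: "\<And>s. s \<in> {l..r} \<Longrightarrow> (y has_vector_derivative f s (y s)) (at s within {l..r})"
    using exists_solution_Lipschitz_ode[OF fc fl _ lr] M1 M2 by (metis add_pos_pos)
  have "sol \<mu> (\<lambda>s. fst (y s)) (\<lambda>s. snd (y s))"
    unfolding sol_def
    using y bounded_linear.has_vector_derivative[OF bounded_linear_fst y] bounded_linear.has_vector_derivative[OF bounded_linear_snd y]
    by (auto simp: has_real_derivative_iff_has_vector_derivative f_def)
  then show ?thesis using y0 by (intro exI[of _ "\<lambda>s. fst (y s)"] exI[of _ "\<lambda>s. snd (y s)"]) auto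
qed


lemma sol_continuous:
  assumes "sol \<mu> V Z"
  shows "continuous_on {l..r} V" "continuous_on {l..r} Z"
proof -
  show "continuous_on {l..r} V"
    using assms by (intro DERIV_continuous_on[of "{l..r}" V "\<lambda>s. Z s / p s"]) (auto simp: sol_def)
  show "continuous_on {l..r} Z"
    using assms by (intro DERIV_continuous_on[of "{l..r}" Z "\<lambda>s. (P s - \<mu> * p s) * V s"]) (auto simp: sol_def)
qed

lemma nondecreasing_if_deriv_nonneg:
  assumes d: "\<And>s. s \<in> {l..r} \<Longrightarrow> (E has_real_derivative E' s) (at s within {l..r})"
    and nn: "\<And>s. s \<in> {l..r} \<Longrightarrow> 0 \<le> E' s" and xy: "l \<le> x" "x \<le> y" "y \<le> r"
  shows "E x \<le> (E y :: real)"
proof -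
  have "(E' has_integral (E y - E x)) {x..y}"
    using xy by (intro fundamental_theorem_of_calculus)
      (auto simp: has_real_derivative_iff_has_vector_derivative[symmetric] intro: DERIV_subset[OF d])
  then have "0 \<le> E y - E x"
    by (rule has_integral_nonneg) (use nn xy in auto)
  then show ?thesis by simp
qed

lemma gronwall:
  assumes d: "\<And>s. s \<in> {l..r} \<Longrightarrow> (D has_real_derivative D' s) (at s within {l..r})"
    and le: "\<And>s. s \<in> {l..r} \<Longrightarrow> D' s \<le> C * D s + c" and "D l = 0" "C \<ge> 0" "c \<ge> 0"
    and s: "s \<in> {l..r}"
  shows "D s \<le> c * ((r - l) * exp (C * (r - l)))"
proof -
  define E where "E s = c * (s - l) - D s * exp (- C * (s - l))" for s
  have "E l \<le> E s"
  proof (rule nondecreasing_if_deriv_nonneg[where E = E and E' = "\<lambda>t. c - (D' t - C * D t) * exp (- C * (t - l))"])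
    fix t assume t: "t \<in> {l..r}"
    show "(E has_real_derivative (c - (D' t - C * D t) * exp (- C * (t - l)))) (at t within {l..r})"
      unfolding E_def[abs_def] by (auto intro!: derivative_eq_intros d[OF t] simp: algebra_simps)
    have "(D' t - C * D t) * exp (- C * (t - l)) \<le> c * exp (- C * (t - l))"
      using le[OF t] by (intro mult_right_mono) auto
    also have "\<dots> \<le> c * 1" using assms t by (intro mult_left_mono) auto
    finally show "0 \<le> c - (D' t - C * D t) * exp (- C * (t - l))" by simp
  qed (use s in auto)
  then have "D s * exp (- C * (s - l)) \<le> c * (s - l)" using assms by (simp add: E_def)
  then have "D s * exp (- C * (s - l)) * exp (C * (s - l)) \<le> c * (s - l) * exp (C * (s - l))"
    by (intro mult_right_mono) auto
  then have "D s \<le> c * (s - l) * exp (C * (s - l))" by (simp add: mult.assoc exp_add[symmetric])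
  also have "\<dots> \<le> c * (r - l) * exp (C * (r - l))"
    using assms by (intro mult_mono) (auto intro!: mult_left_mono)
  finally show ?thesis by (simp add: mult.assoc)
qed

lemma two_mult_abs_le: "2 * (x * y * a) \<le> \<bar>a\<bar> * (x\<^sup>2 + y\<^sup>2)" for x y a :: real
proof -
  have "2 * (x * y * a) \<le> \<bar>a\<bar> * (2 * \<bar>x\<bar> * \<bar>y\<bar>)"
    using abs_ge_self[of "2 * (x * y * a)"] by (simp add: abs_mult mult_ac)
  also have "\<dots> \<le> \<bar>a\<bar> * (x\<^sup>2 + y\<^sup>2)"
    using sum_squares_bound[of "\<bar>x\<bar>" "\<bar>y\<bar>"] by (intro mult_left_mono) auto
  finally show ?thesis .
qed

text \<open>
  Uniqueness backwards in time: \<open>V\<^sup>2 + Z\<^sup>2\<close> can decay at most exponentially.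
\<close>
lemma sol_nonvanishing:
  assumes sol: "sol \<mu> V Z" and "V l \<noteq> 0" and s: "s \<in> {l..r}"
  shows "V s \<noteq> 0 \<or> Z s \<noteq> 0"
proof -
  have q: "continuous_on {l..r} (\<lambda>s. 1 / p s + (P s - \<mu> * p s))"
    using p_pos by (intro continuous_intros p_cont P_cont; force)
  obtain C where C: "C > 0" "\<And>s. s \<in> {l..r} \<Longrightarrow> \<bar>1 / p s + (P s - \<mu> * p s)\<bar> \<le> C"
    using bounded_continuous[OF q] by blast
  define E where "E s = ((V s)\<^sup>2 + (Z s)\<^sup>2) * exp (C * (s - l))" for s
  have "E l \<le> E s"
  proof (rule nondecreasing_if_deriv_nonneg[where E = E and E' = "\<lambda>t. (2 * (V t * Z t * (1 / p t + (P t - \<mu> * p t)))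
        + C * ((V t)\<^sup>2 + (Z t)\<^sup>2)) * exp (C * (t - l))"])
    fix t assume t: "t \<in> {l..r}"
    let ?a = "1 / p t + (P t - \<mu> * p t)"
    have V: "(V has_real_derivative Z t / p t) (at t within {l..r})"
      and Z: "(Z has_real_derivative (P t - \<mu> * p t) * V t) (at t within {l..r})"
      using sol t by (auto simp: sol_def)
    show "(E has_real_derivative (2 * (V t * Z t * ?a) + C * ((V t)\<^sup>2 + (Z t)\<^sup>2)) * exp (C * (t - l))) (at t within {l..r})"
      unfolding E_def[abs_def] using p_pos[OF t]
      by (auto intro!: derivative_eq_intros V Z simp: field_simps power2_eq_square)
    have "2 * (V t * Z t * (- ?a)) \<le> \<bar>- ?a\<bar> * ((V t)\<^sup>2 + (Z t)\<^sup>2)" by (rule two_mult_abs_le)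
    also have "\<dots> \<le> C * ((V t)\<^sup>2 + (Z t)\<^sup>2)"
      using C(2)[OF t] by (intro mult_right_mono) (auto simp: abs_minus_cancel simp del: minus_add_distrib)
    finally show "0 \<le> (2 * (V t * Z t * ?a) + C * ((V t)\<^sup>2 + (Z t)\<^sup>2)) * exp (C * (t - l))"
      by (intro mult_nonneg_nonneg) (auto simp del: minus_add_distrib)
  qed (use s in auto)
  moreover have "E l > 0" using assms by (auto simp: E_def sum_power2_gt_zero_iff)
  ultimately have "E s > 0" by simp
  then show ?thesis by (auto simp: E_def)
qed

lemma sol_flux_integral:
  assumes sol: "sol \<mu> V Z"
  shows "integral {l..r} (\<lambda>s. (P s - \<mu> * p s) * V s) = Z r - Z l"
    and "continuous_on {l..r} (\<lambda>s. (P s - \<mu> * p s) * V s)"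
proof -
  show "integral {l..r} (\<lambda>s. (P s - \<mu> * p s) * V s) = Z r - Z l"
    using sol lr by (intro integral_unique fundamental_theorem_of_calculus)
      (auto simp: has_real_derivative_iff_has_vector_derivative[symmetric] sol_def)
  show "continuous_on {l..r} (\<lambda>s. (P s - \<mu> * p s) * V s)"
    by (intro continuous_intros p_cont P_cont sol_continuous[OF sol])
qed

text \<open>
  At \<open>\<mu> = 0\<close> the product \<open>V Z\<close> is nondecreasing because \<open>P \<ge> 0\<close>, hence \<open>V\<^sup>2\<close> is nondecreasing, and the flux
  at the right endpoint is \<open>\<integral> P V > 0\<close>.
\<close>
lemma sol_zero:
  assumes sol: "sol 0 V Z" and V1: "V l = 1" and Z0: "Z l = 0"
  shows "\<And>s. s \<in> {l..r} \<Longrightarrow> V s > 0" and "Z r > 0"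
proof -
  have V: "(V has_real_derivative Z t / p t) (at t within {l..r})"
    and Z: "(Z has_real_derivative P t * V t) (at t within {l..r})" if "t \<in> {l..r}" for t
    using sol that by (auto simp: sol_def)
  have VZ: "V s * Z s \<ge> 0" if s: "s \<in> {l..r}" for s
  proof -
    have "V l * Z l \<le> V s * Z s"
    proof (rule nondecreasing_if_deriv_nonneg[where E = "\<lambda>s. V s * Z s" and E' = "\<lambda>t. (Z t)\<^sup>2 / p t + P t * (V t)\<^sup>2"])
      fix t assume t: "t \<in> {l..r}"
      show "((\<lambda>s. V s * Z s) has_real_derivative ((Z t)\<^sup>2 / p t + P t * (V t)\<^sup>2)) (at t within {l..r})"
        by (auto intro!: derivative_eq_intros V[OF t] Z[OF t] simp: power2_eq_square)
      show "0 \<le> (Z t)\<^sup>2 / p t + P t * (V t)\<^sup>2" using p_pos[OF t] P_nonneg[OF t] by simp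
    qed (use s in auto)
    then show ?thesis using Z0 by simp
  qed
  have V2: "(V s)\<^sup>2 \<ge> 1" if s: "s \<in> {l..r}" for s
  proof -
    have "(V l)\<^sup>2 \<le> (V s)\<^sup>2"
    proof (rule nondecreasing_if_deriv_nonneg[where E = "\<lambda>s. (V s)\<^sup>2" and E' = "\<lambda>t. 2 * (V t * Z t) / p t"])
      fix t assume t: "t \<in> {l..r}"
      show "((\<lambda>s. (V s)\<^sup>2) has_real_derivative 2 * (V t * Z t) / p t) (at t within {l..r})"
        by (auto intro!: derivative_eq_intros V[OF t])
      show "0 \<le> 2 * (V t * Z t) / p t" using p_pos[OF t] VZ[OF t] by (intro divide_nonneg_pos) auto
    qed (use s in auto)
    then show ?thesis using V1 by simp
  qed
  show pos: "V s > 0" if s: "s \<in> {l..r}" for s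
  proof (rule ccontr)
    assume "\<not> V s > 0"
    then have "\<exists>x\<ge>l. x \<le> s \<and> V x = 0"
      using s V1 by (intro IVT2' continuous_on_subset[OF sol_continuous(1)[OF sol]]) auto
    then show False using V2 s by force
  qed
  have nn: "(P s - 0 * p s) * V s \<ge> 0" if "s \<in> {l..r}" for s
    using P_nonneg[OF that] pos[OF that] by simp
  obtain s where s: "s \<in> {l..r}" "P s > 0" using P_nonzero by blast
  have "integral {l..r} (\<lambda>s. (P s - 0 * p s) * V s) \<noteq> 0"
    using integral_eq_0_iff[OF sol_flux_integral(2)[OF sol] lr nn] s pos[OF s(1)] by force
  moreover have "integral {l..r} (\<lambda>s. (P s - 0 * p s) * V s) \<ge> 0"
    using nn by (intro integral_nonneg integrable_continuous_real sol_flux_integral(2)[OF sol]) auto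
  ultimately show "Z r > 0" using sol_flux_integral(1)[OF sol] Z0 by simp
qed

text \<open>
  Gronwall's inequality for the squared distance \<open>D\<close> of the two solutions, which satisfies
  \<open>D' \<le> C D + m\<^sup>2 (\<mu> - \<mu>0)\<^sup>2\<close>.
\<close>
lemma sol_depends_continuously:
  assumes sol0: "sol \<mu>0 V0 Z0" and \<epsilon>: "\<epsilon> > 0"
  obtains \<delta> where "\<delta> > 0"
    "\<And>\<mu> V Z s. \<bar>\<mu> - \<mu>0\<bar> < \<delta> \<Longrightarrow> sol \<mu> V Z \<Longrightarrow> V l = V0 l \<Longrightarrow> Z l = Z0 l \<Longrightarrow> s \<in> {l..r} \<Longrightarrow>
       \<bar>V s - V0 s\<bar> < \<epsilon> \<and> \<bar>Z s - Z0 s\<bar> < \<epsilon>"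
proof -
  have c: "continuous_on {l..r} (\<lambda>s. 1 / p s)" "continuous_on {l..r} (\<lambda>s. \<bar>P s\<bar> + (\<bar>\<mu>0\<bar> + 1) * p s)"
    "continuous_on {l..r} (\<lambda>s. p s * V0 s)"
    using p_pos by (intro continuous_intros p_cont P_cont sol_continuous[OF sol0]; force)+
  obtain M1 where M1: "M1 > 0" "\<And>s. s \<in> {l..r} \<Longrightarrow> \<bar>1 / p s\<bar> \<le> M1"
    using bounded_continuous[OF c(1)] by blast
  obtain M2 where M2: "M2 > 0" "\<And>s. s \<in> {l..r} \<Longrightarrow> \<bar>\<bar>P s\<bar> + (\<bar>\<mu>0\<bar> + 1) * p s\<bar> \<le> M2"
    using bounded_continuous[OF c(2)] by blast
  obtain m where m: "m > 0" "\<And>s. s \<in> {l..r} \<Longrightarrow> \<bar>p s * V0 s\<bar> \<le> m"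
    using bounded_continuous[OF c(3)] by blast
  define C where "C = M1 + M2 + 1"
  define N where "N = m\<^sup>2 * ((r - l) * exp (C * (r - l)))"
  have N: "N \<ge> 0" using lr by (simp add: N_def)
  define \<delta> where "\<delta> = min 1 (\<epsilon>\<^sup>2 / (N + 1))"
  show ?thesis
  proof
    show "\<delta> > 0" using \<epsilon> N by (simp add: \<delta>_def)
    fix \<mu> V Z s
    assume h: "\<bar>\<mu> - \<mu>0\<bar> < \<delta>" and sol: "sol \<mu> V Z" and ini: "V l = V0 l" "Z l = Z0 l" and s: "s \<in> {l..r}"
    define D where "D s = (V s - V0 s)\<^sup>2 + (Z s - Z0 s)\<^sup>2" for s
    define D' where "D' t = 2 * ((V t - V0 t) * (Z t - Z0 t) * (1 / p t + (P t - \<mu> * p t)))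
        + 2 * ((Z t - Z0 t) * ((\<mu>0 - \<mu>) * (p t * V0 t)) * 1)" for t
    have "D s \<le> ((\<mu> - \<mu>0)\<^sup>2 * m\<^sup>2) * ((r - l) * exp (C * (r - l)))"
    proof (rule gronwall[where D = D and D' = D'])
      fix t assume t: "t \<in> {l..r}"
      have V: "(V has_real_derivative Z t / p t) (at t within {l..r})"
        and Z: "(Z has_real_derivative (P t - \<mu> * p t) * V t) (at t within {l..r})"
        and V0: "(V0 has_real_derivative Z0 t / p t) (at t within {l..r})"
        and Z0: "(Z0 has_real_derivative (P t - \<mu>0 * p t) * V0 t) (at t within {l..r})"
        using sol sol0 t by (auto simp: sol_def)
      show "(D has_real_derivative D' t) (at t within {l..r})"
        unfolding D_def[abs_def] D'_def using p_pos[OF t]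
        by (auto intro!: derivative_eq_intros V Z V0 Z0 simp: field_simps)
      have b: "\<bar>1 / p t + (P t - \<mu> * p t)\<bar> \<le> M1 + M2"
      proof -
        have "\<bar>\<mu>\<bar> \<le> \<bar>\<mu>0\<bar> + 1" using h by (auto simp: \<delta>_def)
        then have "\<bar>\<mu> * p t\<bar> \<le> (\<bar>\<mu>0\<bar> + 1) * p t"
          using p_pos[OF t] by (simp add: abs_mult mult_right_mono)
        then show ?thesis using M1(2)[OF t] M2(2)[OF t] by linarith
      qed
      have "2 * ((V t - V0 t) * (Z t - Z0 t) * (1 / p t + (P t - \<mu> * p t)))
          \<le> \<bar>1 / p t + (P t - \<mu> * p t)\<bar> * D t"
        unfolding D_def by (rule two_mult_abs_le)
      also have "\<dots> \<le> (M1 + M2) * D t"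
        using b by (intro mult_right_mono) (auto simp: D_def)
      finally have 1: "2 * ((V t - V0 t) * (Z t - Z0 t) * (1 / p t + (P t - \<mu> * p t))) \<le> (M1 + M2) * D t" .
      have "2 * ((Z t - Z0 t) * ((\<mu>0 - \<mu>) * (p t * V0 t)) * 1)
          \<le> \<bar>1\<bar> * ((Z t - Z0 t)\<^sup>2 + ((\<mu>0 - \<mu>) * (p t * V0 t))\<^sup>2)"
        by (rule two_mult_abs_le)
      also have "\<dots> \<le> D t + (\<mu> - \<mu>0)\<^sup>2 * m\<^sup>2"
      proof -
        have "((\<mu>0 - \<mu>) * (p t * V0 t))\<^sup>2 = (\<mu> - \<mu>0)\<^sup>2 * \<bar>p t * V0 t\<bar>\<^sup>2"
          by (simp add: power_mult_distrib power2_commute)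
        also have "\<dots> \<le> (\<mu> - \<mu>0)\<^sup>2 * m\<^sup>2"
          using m(2)[OF t] by (intro mult_left_mono power_mono) auto
        finally show ?thesis by (simp add: D_def add_increasing)
      qed
      finally show "D' t \<le> C * D t + (\<mu> - \<mu>0)\<^sup>2 * m\<^sup>2"
        using 1 unfolding D'_def C_def by (simp add: algebra_simps)
    qed (use s ini M1 M2 in \<open>auto simp: D_def C_def\<close>)
    also have "\<dots> = (\<mu> - \<mu>0)\<^sup>2 * N" by (simp add: N_def)
    also have "\<dots> = \<bar>\<mu> - \<mu>0\<bar> * (\<bar>\<mu> - \<mu>0\<bar> * N)" by (simp add: power2_eq_square)
    also have "\<dots> \<le> 1 * (\<bar>\<mu> - \<mu>0\<bar> * (N + 1))"
      using h N by (intro mult_mono) (auto simp: \<delta>_def algebra_simps)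
    also have "\<dots> < \<epsilon>\<^sup>2"
      using h N by (simp add: \<delta>_def field_simps)
    finally have "D s < \<epsilon>\<^sup>2" .
    then have "(V s - V0 s)\<^sup>2 < \<epsilon>\<^sup>2" "(Z s - Z0 s)\<^sup>2 < \<epsilon>\<^sup>2"
      unfolding D_def by (meson le_add_same_cancel1 le_add_same_cancel2 order_le_less_trans zero_le_power2)+
    then show "\<bar>V s - V0 s\<bar> < \<epsilon> \<and> \<bar>Z s - Z0 s\<bar> < \<epsilon>"
      using \<epsilon> power2_less_imp_less[of "\<bar>V s - V0 s\<bar>" \<epsilon>] power2_less_imp_less[of "\<bar>Z s - Z0 s\<bar>" \<epsilon>] by simp
  qed
qed

text \<open>
  The parameters from \<open>0\<close> up to the lowest Neumann eigenvalue, described by shooting from \<open>l\<close>: the flux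
  of a positive solution stays nonnegative at \<open>r\<close> until it vanishes there at the eigenvalue.
\<close>
definition admissible :: "real \<Rightarrow> bool" where
  "admissible \<mu> \<longleftrightarrow> \<mu> \<ge> 0 \<and> (\<exists>V Z. sol \<mu> V Z \<and> V l = 1 \<and> Z l = 0 \<and> (\<forall>s\<in>{l..r}. V s > 0) \<and> Z r \<ge> 0)"

text \<open>
  If \<open>\<mu>\<close> exceeds the maximum of \<open>P / p\<close>, then the flux \<open>\<integral> (P - \<mu> p) V\<close> of a positive solution is negative.
\<close>
lemma admissible_bounded: "bdd_above {\<mu>. admissible \<mu>}"
proof -
  have c: "continuous_on {l..r} (\<lambda>s. P s / p s)"
    using p_pos by (intro continuous_intros p_cont P_cont; force)
  obtain M where M: "M > 0" "\<And>s. s \<in> {l..r} \<Longrightarrow> \<bar>P s / p s\<bar> \<le> M"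
    using bounded_continuous[OF c] by blast
  have "\<mu> \<le> M" if g: "admissible \<mu>" for \<mu>
  proof (rule ccontr)
    assume "\<not> \<mu> \<le> M"
    obtain V Z where sol: "sol \<mu> V Z" and VZ: "Z l = 0" "\<forall>s\<in>{l..r}. V s > 0" "Z r \<ge> 0"
      using g by (auto simp: admissible_def)
    have neg: "(P s - \<mu> * p s) * V s < 0" if s: "s \<in> {l..r}" for s
    proof -
      have "P s / p s < \<mu>" using M(2)[OF s] \<open>\<not> \<mu> \<le> M\<close> by linarith
      then have "P s < \<mu> * p s" using p_pos[OF s] by (simp add: field_simps)
      then show ?thesis using VZ s by (simp add: mult_neg_pos)
    qed
    let ?f = "\<lambda>s. - ((P s - \<mu> * p s) * V s)"
    have c: "continuous_on {l..r} ?f" by (rule continuous_on_minus[OF sol_flux_integral(2)[OF sol]])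
    have "integral {l..r} ?f = - Z r" using sol_flux_integral(1)[OF sol] VZ by simp
    moreover have "integral {l..r} ?f \<ge> 0"
      using neg by (intro integral_nonneg integrable_continuous_real c) (auto simp: less_imp_le)
    ultimately have "integral {l..r} ?f = 0" using VZ by simp
    moreover have "?f s \<ge> 0" if "s \<in> {l..r}" for s using neg[OF that] by simp
    ultimately have "?f l = 0" using integral_eq_0_iff[OF c lr] lr by (metis atLeastAtMost_iff less_imp_le order_refl)
    then show False using neg[of l] lr by force
  qed
  then show ?thesis by (intro bdd_aboveI[of _ M]) auto
qed

text \<open>
  Let \<open>\<mu>\<close> be the supremum of the admissible parameters. By continuity \<open>V \<ge> 0\<close> and \<open>Z r \<ge> 0\<close>. At a zero of
  \<open>V\<close> the flux would vanish as well, which is excluded by \<open>sol_nonvanishing\<close>, so \<open>V > 0\<close>. If \<open>Z r > 0\<close>,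
  then slightly larger parameters would still be admissible. So \<open>Z r = 0\<close>, and \<open>\<mu> \<noteq> 0\<close> by \<open>sol_zero\<close>.
\<close>
proposition neumann_ground_state:
  obtains \<mu> V Z where "\<mu> > 0" "sol \<mu> V Z" "\<And>s. s \<in> {l..r} \<Longrightarrow> V s > 0" "Z l = 0" "Z r = 0"
proof -
  obtain V0 Z0 where 0: "sol 0 V0 Z0" "V0 l = 1" "Z0 l = 0" using sol_exists by blast
  have g0: "admissible 0" unfolding admissible_def using 0 sol_zero[OF 0] by (intro conjI exI[of _ V0] exI[of _ Z0]) auto
  define \<mu> where "\<mu> = Sup {\<mu>. admissible \<mu>}"
  have \<mu>0: "\<mu> \<ge> 0" unfolding \<mu>_def by (rule cSup_upper) (use g0 admissible_bounded in auto)
  obtain V Z where sol: "sol \<mu> V Z" and V1: "V l = 1" and Z0: "Z l = 0" using sol_exists by blast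
  have near: "\<exists>V' Z'. (\<forall>s\<in>{l..r}. V' s > 0 \<and> \<bar>V' s - V s\<bar> < \<epsilon>) \<and> Z' r \<ge> 0 \<and> \<bar>Z' r - Z r\<bar> < \<epsilon>" if "\<epsilon> > 0" for \<epsilon>
  proof -
    obtain \<delta> where \<delta>: "\<delta> > 0"
      "\<And>\<nu> V' Z' s. \<bar>\<nu> - \<mu>\<bar> < \<delta> \<Longrightarrow> sol \<nu> V' Z' \<Longrightarrow> V' l = V l \<Longrightarrow> Z' l = Z l \<Longrightarrow> s \<in> {l..r} \<Longrightarrow>
        \<bar>V' s - V s\<bar> < \<epsilon> \<and> \<bar>Z' s - Z s\<bar> < \<epsilon>"
      using sol_depends_continuously[OF sol \<open>\<epsilon> > 0\<close>] by blast
    obtain \<nu> where \<nu>: "admissible \<nu>" "\<mu> - \<delta> < \<nu>"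
      using less_cSupD[of "{\<mu>. admissible \<mu>}" "\<mu> - \<delta>"] g0 \<delta>(1) unfolding \<mu>_def by auto
    have "\<nu> \<le> \<mu>" unfolding \<mu>_def by (rule cSup_upper) (use \<nu> admissible_bounded in auto)
    then have n: "\<bar>\<nu> - \<mu>\<bar> < \<delta>" using \<nu> \<delta> by simp
    obtain V' Z' where V': "sol \<nu> V' Z'" "V' l = 1" "Z' l = 0" "\<forall>s\<in>{l..r}. V' s > 0" "Z' r \<ge> 0"
      using \<nu> by (auto simp: admissible_def)
    show ?thesis
      using \<delta>(2)[OF n V'(1)] V' V1 Z0 lr by (intro exI[of _ V'] exI[of _ Z']) auto
  qed
  have Vnn: "V s \<ge> 0" if "s \<in> {l..r}" for s
  proof (rule ccontr)
    assume "\<not> V s \<ge> 0"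
    then show False using near[of "- V s"] that by force
  qed
  have Zr: "Z r \<ge> 0"
  proof (rule ccontr)
    assume "\<not> Z r \<ge> 0"
    then show False using near[of "- Z r"] by force
  qed
  have Vpos: "V s > 0" if s: "s \<in> {l..r}" for s
  proof (rule ccontr)
    assume "\<not> V s > 0"
    then have V0: "V s = 0" using Vnn[OF s] by simp
    then have sl: "l < s" using V1 s by (cases "s = l") auto
    have d: "(V has_real_derivative Z s / p s) (at s within {l..r})" using sol s by (auto simp: sol_def)
    \<comment> \<open>A nonzero slope at the zero \<open>s\<close> would make \<open>V\<close> negative next to it, inside the interval.\<close>
    have "\<not> Z s > 0"
    proof
      assume "Z s > 0"
      then have "Z s / p s > 0" using p_pos[OF s] by simp
      then obtain e where e: "e > 0" "\<And>h. h > 0 \<Longrightarrow> s - h \<in> {l..r} \<Longrightarrow> h < e \<Longrightarrow> V (s - h) < V s"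
        using has_real_derivative_pos_inc_left[OF d] by blast
      have "V (s - min (e/2) (s - l)) < 0"
        using e(2)[of "min (e/2) (s - l)"] e(1) sl s V0 by (auto simp: min_def)
      moreover have "s - min (e/2) (s - l) \<in> {l..r}" using e(1) sl s by auto
      ultimately show False using Vnn by force
    qed
    moreover have "\<not> Z s < 0"
    proof
      assume n: "Z s < 0"
      then have sr: "s < r" using Zr s by (cases "s = r") auto
      have "Z s / p s < 0" using p_pos[OF s] n by (simp add: divide_neg_pos)
      then obtain e where e: "e > 0" "\<And>h. h > 0 \<Longrightarrow> s + h \<in> {l..r} \<Longrightarrow> h < e \<Longrightarrow> V (s + h) < V s"
        using has_real_derivative_neg_dec_right[OF d] by blast
      have "V (s + min (e/2) (r - s)) < 0"
        using e(2)[of "min (e/2) (r - s)"] e(1) sr s V0 by (auto simp: min_def)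
      moreover have "s + min (e/2) (r - s) \<in> {l..r}" using e(1) sr s by auto
      ultimately show False using Vnn by force
    qed
    ultimately show False using sol_nonvanishing[OF sol _ s] V0 V1 by simp
  qed
  have "\<not> Z r > 0"
  proof
    assume zr: "Z r > 0"
    obtain x where x: "x \<in> {l..r}" "\<And>y. y \<in> {l..r} \<Longrightarrow> V x \<le> V y"
      using continuous_attains_inf[OF compact_Icc _ sol_continuous(1)[OF sol]] lr by auto
    define \<epsilon> where "\<epsilon> = min (V x) (Z r)"
    have "\<epsilon> > 0" using Vpos[OF x(1)] zr by (simp add: \<epsilon>_def)
    then obtain \<delta> where \<delta>: "\<delta> > 0"
      "\<And>\<nu> V' Z' s. \<bar>\<nu> - \<mu>\<bar> < \<delta> \<Longrightarrow> sol \<nu> V' Z' \<Longrightarrow> V' l = V l \<Longrightarrow> Z' l = Z l \<Longrightarrow> s \<in> {l..r} \<Longrightarrow>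
        \<bar>V' s - V s\<bar> < \<epsilon> \<and> \<bar>Z' s - Z s\<bar> < \<epsilon>"
      using sol_depends_continuously[OF sol] by blast
    obtain V' Z' where V': "sol (\<mu> + \<delta> / 2) V' Z'" "V' l = 1" "Z' l = 0" using sol_exists by blast
    have cl: "\<bar>V' s - V s\<bar> < \<epsilon> \<and> \<bar>Z' s - Z s\<bar> < \<epsilon>" if "s \<in> {l..r}" for s
      by (rule \<delta>(2)[OF _ V'(1)]) (use V' V1 Z0 \<delta>(1) that in auto)
    have "V' s > 0" if "s \<in> {l..r}" for s
      using cl[OF that] x(2)[OF that] unfolding \<epsilon>_def by linarith
    moreover have "Z' r \<ge> 0" using cl[of r] lr unfolding \<epsilon>_def by auto
    ultimately have "admissible (\<mu> + \<delta> / 2)"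
      unfolding admissible_def using V' \<mu>0 \<delta>(1) by (intro conjI exI[of _ V'] exI[of _ Z']) auto
    then have "\<mu> + \<delta> / 2 \<le> \<mu>" unfolding \<mu>_def[symmetric]
      using cSup_upper[OF _ admissible_bounded, of "\<mu> + \<delta> / 2"] by (simp add: \<mu>_def)
    then show False using \<delta>(1) by simp
  qed
  then have Zr0: "Z r = 0" using Zr by simp
  have "\<mu> \<noteq> 0" using sol_zero(2)[of V Z] sol V1 Z0 Zr0 by auto
  then show ?thesis using that[of \<mu> V Z] \<mu>0 sol Vpos Z0 Zr0 by auto
qed

end

section \<open>Geometry of the critical catenoid\<close>

context
  fixes a :: real
  assumes a: "1 / 2 < a"
begin

lemma radicand_ge: "a * cosh (2 * s) - 1 / 2 \<ge> a - 1 / 2"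
  using a cosh_real_ge_1[of "2 * s"] mult_left_mono[of 1 "cosh (2 * s)" a] by simp

lemma radicand_gt: "a * cosh (2 * s) > 1 / 2"
  using radicand_ge[of s] a by linarith

lemma B_sq: "(cat_B a s)\<^sup>2 = a * cosh (2 * s) - 1 / 2"
  and B_pos: "cat_B a s > 0"
  using radicand_gt[of s] by (auto simp: cat_B_def)

lemma A_sq: "(cat_A a s)\<^sup>2 = (cat_B a s)\<^sup>2 + 1"
  and A_gt_1: "cat_A a s > 1"
  using radicand_gt[of s] by (auto simp: cat_A_def B_sq)

lemma B_sq_ge: "(cat_B a s)\<^sup>2 \<ge> a - 1 / 2"
  using radicand_ge[of s] by (simp add: B_sq)

lemma K_sq: "(cat_K a)\<^sup>2 = a\<^sup>2 - 1 / 4"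
  and K_pos: "cat_K a > 0"
proof -
  have "a\<^sup>2 > (1/2)\<^sup>2" by (rule power_strict_mono) (use a in auto)
  then have "a\<^sup>2 - 1/4 > 0" by (simp add: power2_eq_square)
  then show "(cat_K a)\<^sup>2 = a\<^sup>2 - 1 / 4" "cat_K a > 0" by (auto simp: cat_K_def)
qed

text \<open>
  The square of \<open>B B' = a sinh (2 s)\<close> in terms of \<open>b = B\<^sup>2\<close> is \<open>b\<^sup>2 + b - K\<^sup>2\<close>; with it all identities below become
  algebraic identities in \<open>b\<close>.
\<close>
lemma sinh_sq_eq: "(a * sinh (2 * s))\<^sup>2 = (cat_B a s) ^ 4 + (cat_B a s)\<^sup>2 - (cat_K a)\<^sup>2"
proof -
  have 4: "(cat_B a s) ^ 4 = ((cat_B a s)\<^sup>2)\<^sup>2" by simp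
  have s: "(sinh (2 * s))\<^sup>2 = (cosh (2 * s))\<^sup>2 - 1" by (rule sinh_square_eq)
  show ?thesis
    unfolding 4 B_sq K_sq power_mult_distrib s by (simp add: power2_eq_square algebra_simps)
qed

lemma B_deriv: "(cat_B a has_real_derivative a * sinh (2 * s) / cat_B a s) (at s within S)"
proof -
  have p: "a * cosh (2 * s) - 1 / 2 > 0" using radicand_gt[of s] by simp
  have "((\<lambda>s. sqrt (a * cosh (2 * s) - 1 / 2)) has_real_derivative a * sinh (2 * s) / sqrt (a * cosh (2 * s) - 1 / 2)) (at s within S)"
    using p by (auto intro!: derivative_eq_intros simp: field_simps)
  then show ?thesis by (simp add: cat_B_def[abs_def])
qed

lemma B_cont: "continuous_on S (cat_B a)"
  by (rule DERIV_continuous_on) (rule B_deriv)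

lemma A_cont: "continuous_on S (cat_A a)"
  unfolding cat_A_def[abs_def] by (intro continuous_intros)

lemma B_strict_mono: "cat_B a x < cat_B a y" if "0 \<le> x" "x < y" for x y
proof -
  have "cosh (2 * x) < cosh (2 * y)" using that by (subst cosh_real_nonneg_less_iff) auto
  then have "(cat_B a x)\<^sup>2 < (cat_B a y)\<^sup>2" using a by (simp add: B_sq)
  then show ?thesis using B_pos[of y] by (simp add: power2_less_imp_less)
qed

lemma arcosh_pos: "arcosh x > 0" if "x > 1" for x :: real
  using that arcosh_real_gt_1_iff[of x] by simp

lemma B_attains:
  assumes "t > a - 1 / 2"
  obtains s where "s > 0" "(cat_B a s)\<^sup>2 = t"
proof -
  have c: "(t + 1 / 2) / a > 1" using assms a by (simp add: field_simps)
  show ?thesis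
  proof
    show "arcosh ((t + 1 / 2) / a) / 2 > 0" using arcosh_pos[OF c] by linarith
    have "cosh (2 * (arcosh ((t + 1 / 2) / a) / 2)) = (t + 1 / 2) / a"
      using cosh_arcosh_real[of "(t + 1 / 2) / a"] c by simp
    then show "(cat_B a (arcosh ((t + 1 / 2) / a) / 2))\<^sup>2 = t"
      unfolding B_sq using a by simp
  qed
qed

lemma phi_primitive:
  obtains F where "\<And>s. (F has_real_derivative cat_K a / ((cat_A a s)\<^sup>2 * cat_B a s)) (at s)"
    "\<And>s. cat_phi a s = F s - F 0"
proof -
  let ?f = "\<lambda>s. cat_K a / ((cat_A a s)\<^sup>2 * cat_B a s)"
  have nz: "(cat_A a s)\<^sup>2 * cat_B a s \<noteq> 0" for s using A_gt_1[of s] B_pos[of s] by simp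
  have f: "continuous_on S ?f" for S
    using nz by (intro continuous_intros A_cont B_cont) auto
  obtain F where F: "\<And>s. (F has_real_derivative ?f s) (at s)"
    using continuous_antiderivative[OF f] by blast
  have "cat_phi a s = F s - F 0" for s
    unfolding cat_phi_def zero_ereal_def
    by (rule interval_integral_FTC_finite[OF f])
      (auto simp: has_real_derivative_iff_has_vector_derivative[symmetric] intro: DERIV_subset[OF F])
  then show ?thesis using that F by blast
qed

lemma phi_strict_mono: "x < y \<Longrightarrow> cat_phi a x < cat_phi a y"
  and phi_cont: "continuous_on S (cat_phi a)"
  and phi_0: "cat_phi a 0 = 0"
proof -
  obtain F where F: "\<And>s. (F has_real_derivative cat_K a / ((cat_A a s)\<^sup>2 * cat_B a s)) (at s)"
    and phi: "\<And>s. cat_phi a s = F s - F 0" using phi_primitive by blast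
  have pos: "cat_K a / ((cat_A a s)\<^sup>2 * cat_B a s) > 0" for s
    using A_gt_1[of s] B_pos[of s] K_pos by simp
  show "cat_phi a x < cat_phi a y" if "x < y"
  proof -
    have "F x < F y"
      by (rule DERIV_pos_imp_increasing[OF that]) (use F pos in blast)
    then show ?thesis by (simp add: phi)
  qed
  show "continuous_on S (cat_phi a)"
  proof -
    have "continuous_on S F"
      by (rule DERIV_continuous_on) (rule DERIV_subset[OF F], simp)
    then have "continuous_on S (\<lambda>s. F s - F 0)" by (intro continuous_intros)
    moreover have "cat_phi a = (\<lambda>s. F s - F 0)" by (rule ext) (rule phi)
    ultimately show ?thesis by simp
  qed
  show "cat_phi a 0 = 0" by (simp add: phi)
qed

text \<open>
  The right-hand side of the equation that determines \<open>s\<^sub>0\<close>.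
\<close>
definition bdry_ratio :: "real \<Rightarrow> real" where
  "bdry_ratio s = cat_B a s * cat_K a / (a * sinh (2 * s))"

lemma bdry_ratio_sq: "0 < s \<Longrightarrow> (bdry_ratio s)\<^sup>2 * (a * sinh (2 * s))\<^sup>2 = (cat_B a s)\<^sup>2 * (cat_K a)\<^sup>2"
  using a by (simp add: bdry_ratio_def power_mult_distrib power_divide)

text \<open>
  With \<open>b\<close> the value of \<open>B\<^sup>2\<close>, the reciprocal of the square of the ratio is \<open>(b + 1) / K\<^sup>2 - 1 / b\<close>, which is
  increasing in \<open>b\<close>.
\<close>
lemma bdry_ratio_strict_antimono:
  assumes "0 < x" "x < y"
  shows "bdry_ratio y < bdry_ratio x"
proof -
  let ?b = "\<lambda>s. (cat_B a s)\<^sup>2"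
  have b: "?b x < ?b y" using B_strict_mono[of x y] assms B_pos[of x] by (simp add: power_strict_mono)
  have bx: "?b x > 0" "?b y > 0" using B_pos[of x] B_pos[of y] by auto
  have "0 < (?b y - ?b x) * (?b x * ?b y + (cat_K a)\<^sup>2)"
    using b bx by (intro mult_pos_pos add_pos_nonneg) auto
  then have "?b y * (a * sinh (2 * x))\<^sup>2 < ?b x * (a * sinh (2 * y))\<^sup>2"
    unfolding sinh_sq_eq by (simp add: algebra_simps power4_eq_xxxx power2_eq_square)
  then have "(cat_B a y * (a * sinh (2 * x)))\<^sup>2 < (cat_B a x * (a * sinh (2 * y)))\<^sup>2"
    by (simp add: power_mult_distrib)
  then have "cat_B a y * (a * sinh (2 * x)) < cat_B a x * (a * sinh (2 * y))"
    by (rule power2_less_imp_less) (use assms a B_pos[of x] in auto)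
  then have "cat_K a * (cat_B a y * (a * sinh (2 * x))) < cat_K a * (cat_B a x * (a * sinh (2 * y)))"
    using K_pos by simp
  then show ?thesis
    using assms a by (simp add: bdry_ratio_def divide_less_eq less_divide_eq mult_ac)
qed

text \<open>
  Intermediate value theorem. At the point \<open>s1\<close> where \<open>B = K\<close> the ratio is \<open>1\<close> and so exceeds the value
  \<open>T\<close> of \<open>tanh \<phi>\<close> there. Beyond \<open>s1\<close> the ratio is at most \<open>K / B\<close>, so at the point \<open>s2\<close> where \<open>B = K / T\<close> it
  has fallen to at most \<open>T\<close>, while \<open>tanh \<phi>\<close> has grown.
\<close>
lemma s0_exists: "\<exists>s>0. tanh (cat_phi a s) = bdry_ratio s"
proof -
  have "(cat_K a)\<^sup>2 - (a - 1 / 2) = (a - 1 / 2)\<^sup>2" unfolding K_sq by (simp add: power2_eq_square algebra_simps)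
  moreover have "(a - 1 / 2)\<^sup>2 > 0" using a by simp
  ultimately have K: "(cat_K a)\<^sup>2 > a - 1 / 2" by linarith
  obtain s1 where s1: "s1 > 0" "(cat_B a s1)\<^sup>2 = (cat_K a)\<^sup>2"
    using B_attains[OF K] by blast
  have "cat_B a s1 = cat_K a" using s1 B_pos[of s1] K_pos by (simp add: power2_eq_iff)
  then have "(a * sinh (2 * s1))\<^sup>2 = ((cat_K a)\<^sup>2)\<^sup>2" unfolding sinh_sq_eq by simp
  then have "a * sinh (2 * s1) = (cat_K a)\<^sup>2"
    by (rule power2_eq_imp_eq) (use a s1 in auto)
  then have r1: "bdry_ratio s1 = 1"
    unfolding bdry_ratio_def using \<open>cat_B a s1 = cat_K a\<close> K_pos by (simp add: power2_eq_square)
  define T where "T = tanh (cat_phi a s1)"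
  have "cat_phi a s1 > 0" using phi_strict_mono[OF s1(1)] phi_0 by simp
  then have T: "T > 0" "T < 1" by (auto simp: T_def tanh_real_lt_1)
  have T2: "T\<^sup>2 < 1" "T\<^sup>2 > 0" using T by (auto simp: power_less_one_iff abs_square_less_1)
  then have K2: "(cat_K a)\<^sup>2 / T\<^sup>2 > (cat_K a)\<^sup>2" using K_pos by (simp add: field_simps)
  then have "(cat_K a)\<^sup>2 / T\<^sup>2 > a - 1 / 2" using K by linarith
  then obtain s2 where s2: "s2 > 0" "(cat_B a s2)\<^sup>2 = (cat_K a)\<^sup>2 / T\<^sup>2"
    using B_attains by blast
  let ?b = "(cat_B a s2)\<^sup>2"
  have bK: "?b > (cat_K a)\<^sup>2" using s2 K2 by simp
  have bpos: "?b > 0" using B_pos[of s2] by simp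
  have s12: "s1 < s2"
  proof (rule ccontr)
    assume "\<not> s1 < s2"
    then have "cat_B a s2 \<le> cat_B a s1" using B_strict_mono[of s2 s1] s2 by (cases "s1 = s2") auto
    then have "?b \<le> (cat_B a s1)\<^sup>2" using B_pos[of s2] by (simp add: power_mono)
    then show False using bK s1 by simp
  qed
  have "(bdry_ratio s2)\<^sup>2 * ?b\<^sup>2 \<le> (bdry_ratio s2)\<^sup>2 * (a * sinh (2 * s2))\<^sup>2"
    unfolding sinh_sq_eq using bK by (intro mult_left_mono) auto
  also have "\<dots> = ?b * (?b * T\<^sup>2)" using bdry_ratio_sq[OF s2(1)] s2(2) T by simp
  finally have "(bdry_ratio s2)\<^sup>2 * ?b\<^sup>2 \<le> T\<^sup>2 * ?b\<^sup>2" by (simp add: power2_eq_square mult_ac)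
  then have "(bdry_ratio s2)\<^sup>2 \<le> T\<^sup>2" using bpos by simp
  then have r2: "bdry_ratio s2 \<le> T" by (rule power2_le_imp_le) (use T in simp)
  have t2: "T < tanh (cat_phi a s2)" using phi_strict_mono[OF s12] by (simp add: T_def)
  have c: "continuous_on {s1..s2} (\<lambda>s. tanh (cat_phi a s) - bdry_ratio s)"
    unfolding bdry_ratio_def using s1 a
    by (intro continuous_intros phi_cont B_cont) (auto simp: cosh_real_nonzero)
  have "\<exists>s\<ge>s1. s \<le> s2 \<and> tanh (cat_phi a s) - bdry_ratio s = 0"
  proof (rule IVT'[OF _ _ _ c])
    show "tanh (cat_phi a s1) - bdry_ratio s1 \<le> 0" using r1 T(2) by (simp add: T_def)
    show "0 \<le> tanh (cat_phi a s2) - bdry_ratio s2" using r2 t2 by linarith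
  qed (use s12 in simp)
  then obtain s where "s1 \<le> s" "tanh (cat_phi a s) - bdry_ratio s = 0" by blast
  then show ?thesis using s1(1) by (intro exI[of _ s]) auto
qed

lemma s0_spec: "cat_s0 a > 0" "tanh (cat_phi a (cat_s0 a)) = bdry_ratio (cat_s0 a)"
proof -
  have uniq: "s = t" if "s > 0" "t > 0" "tanh (cat_phi a s) = bdry_ratio s" "tanh (cat_phi a t) = bdry_ratio t" for s t
  proof -
    have "\<not> x < y" if "x > 0" "tanh (cat_phi a x) = bdry_ratio x" "tanh (cat_phi a y) = bdry_ratio y" for x y
    proof
      assume "x < y"
      then have "tanh (cat_phi a x) < tanh (cat_phi a y)" using phi_strict_mono by simp
      moreover have "bdry_ratio y < bdry_ratio x" using bdry_ratio_strict_antimono \<open>x < y\<close> \<open>x > 0\<close> by simp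
      ultimately show False using that by simp
    qed
    then show ?thesis using that by (metis linorder_neqE_linordered_idom)
  qed
  have "\<exists>!s. s > 0 \<and> tanh (cat_phi a s) = bdry_ratio s" using s0_exists uniq by blast
  from theI'[OF this] show "cat_s0 a > 0" "tanh (cat_phi a (cat_s0 a)) = bdry_ratio (cat_s0 a)"
    by (auto simp: cat_s0_def bdry_ratio_def)
qed

lemma r_spec: "cat_r a > 0" "cosh (cat_r a) = cat_A a (cat_s0 a) * cosh (cat_phi a (cat_s0 a))"
proof -
  let ?y = "cat_A a (cat_s0 a) * cosh (cat_phi a (cat_s0 a))"
  have "1 * 1 < ?y" using A_gt_1 cosh_real_ge_1 by (intro mult_less_le_imp_less) auto
  then have y: "?y > 1" by simp
  have "\<exists>!r. r > 0 \<and> cosh r = ?y"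
  proof
    show "arcosh ?y > 0 \<and> cosh (arcosh ?y) = ?y" using y arcosh_pos[OF y] cosh_arcosh_real[of ?y] by simp
    show "r = arcosh ?y" if "r > 0 \<and> cosh r = ?y" for r
      using that arcosh_cosh_real[of r] by auto
  qed
  from theI'[OF this] show "cat_r a > 0" "cosh (cat_r a) = ?y"
    by (auto simp: cat_r_def)
qed

text \<open>
  The Robin coefficient is the logarithmic derivative of \<open>B\<close> at \<open>s\<^sub>0\<close>, as \<open>B' = a sinh (2 s) / B\<close>. Let
  \<open>X = cosh\<^sup>2 r = (b + 1) cosh\<^sup>2 \<phi>\<close>. Inserting \<open>tanh \<phi>\<close> into \<open>1 - tanh\<^sup>2 \<phi> = 1 / cosh\<^sup>2 \<phi>\<close> gives
  \<open>X (b - K\<^sup>2) = (a sinh (2 s))\<^sup>2\<close>, and then \<open>(X - 1) (b - K\<^sup>2) = b\<^sup>2\<close> by \<open>sinh_sq_eq\<close>. The quotient of the two is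
  \<open>coth\<^sup>2 r\<close>.
\<close>
lemma coth_r: "coth (cat_r a) = a * sinh (2 * cat_s0 a) / (cat_B a (cat_s0 a))\<^sup>2"
proof -
  define s where "s = cat_s0 a"
  define b where "b = (cat_B a s)\<^sup>2"
  define S where "S = a * sinh (2 * s)"
  define X where "X = (cosh (cat_r a))\<^sup>2"
  define C where "C = (cosh (cat_phi a s))\<^sup>2"
  have s: "s > 0" using s0_spec by (simp add: s_def)
  have S: "S > 0" "S\<^sup>2 = b\<^sup>2 + b - (cat_K a)\<^sup>2"
    using s a by (auto simp: S_def sinh_sq_eq b_def)
  have b: "b > 0" using B_pos[of s] by (simp add: b_def)
  have XC: "X = (b + 1) * C" using r_spec(2) by (simp add: X_def C_def b_def s_def power_mult_distrib A_sq)
  have "(bdry_ratio s)\<^sup>2 * C = C - 1"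
  proof -
    have "tanh (cat_phi a s) * cosh (cat_phi a s) = sinh (cat_phi a s)"
      by (simp add: tanh_def)
    then have "(bdry_ratio s)\<^sup>2 * C = (sinh (cat_phi a s))\<^sup>2"
      using s0_spec(2) by (simp add: C_def s_def power_mult_distrib[symmetric])
    then show ?thesis by (simp add: sinh_square_eq C_def)
  qed
  moreover have "(bdry_ratio s)\<^sup>2 * S\<^sup>2 = b * (cat_K a)\<^sup>2" using bdry_ratio_sq[OF s] by (simp add: S_def b_def)
  ultimately have "(C - 1) * S\<^sup>2 = b * (cat_K a)\<^sup>2 * C" by (metis mult.assoc mult.commute)
  then have "C * (b + 1) * (b - (cat_K a)\<^sup>2) = S\<^sup>2"
    unfolding S(2) by (simp add: algebra_simps power2_eq_square)
  then have X1: "X * (b - (cat_K a)\<^sup>2) = S\<^sup>2" by (simp add: XC mult_ac)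
  then have X2: "(X - 1) * (b - (cat_K a)\<^sup>2) = b\<^sup>2" unfolding S(2) by (simp add: algebra_simps)
  have nz: "b - (cat_K a)\<^sup>2 \<noteq> 0" using X1 S(1) by auto
  have "(sinh (cat_r a))\<^sup>2 = X - 1" by (simp add: X_def sinh_square_eq)
  then have "(sinh (cat_r a) * S)\<^sup>2 * (b - (cat_K a)\<^sup>2) = X * (b - (cat_K a)\<^sup>2) * ((X - 1) * (b - (cat_K a)\<^sup>2))"
    by (simp add: power_mult_distrib X1[symmetric] mult_ac)
  also have "\<dots> = (cosh (cat_r a) * b)\<^sup>2 * (b - (cat_K a)\<^sup>2)"
    unfolding X2 by (simp add: power_mult_distrib X_def mult_ac)
  finally have "(sinh (cat_r a) * S)\<^sup>2 = (cosh (cat_r a) * b)\<^sup>2" using nz by simp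
  then have "sinh (cat_r a) * S = cosh (cat_r a) * b"
    by (rule power2_eq_imp_eq) (use r_spec(1) S b in auto)
  moreover have "sinh (cat_r a) > 0" using r_spec(1) by simp
  ultimately show ?thesis
    using b unfolding coth_def S_def[symmetric] b_def[symmetric] s_def[symmetric] by (simp add: field_simps)
qed

end

section \<open>The lowest even eigenvalue of the radial form\<close>

lemma has_real_derivative_reflect:
  fixes f :: "real \<Rightarrow> real"
  assumes "(f has_real_derivative D) (at (- s) within {- r..r})"
  shows "((\<lambda>s. f (- s)) has_real_derivative - D) (at s within {- r..r})"
proof -
  have "uminus ` {- r..r} = {- r..r}" by (simp add: image_uminus_atLeastAtMost)
  then have "(f \<circ> uminus has_real_derivative D * - 1) (at s within {- r..r})"
    using assms by (intro DERIV_image_chain) (auto intro!: derivative_eq_intros)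
  then show ?thesis by (simp add: o_def)
qed

context
  fixes a :: real and k :: int
  assumes a: "1 / 2 < a" and a1: "a \<le> 1" and k: "\<bar>k\<bar> \<ge> 2"
begin

text \<open>
  Here \<open>a \<le> 1\<close> enters: since \<open>K\<^sup>2 = (a - 1/2) (a + 1/2)\<close>, the claim is \<open>2 a + 1 \<le> 3\<close>.
\<close>
lemma potential_bound: "2 * (cat_K a)\<^sup>2 \<le> 3 * (a - 1 / 2)"
proof -
  have "3 * (a - 1 / 2) - 2 * (cat_K a)\<^sup>2 = 2 * ((a - 1 / 2) * (1 - a))"
    unfolding K_sq[OF a] by (simp add: power2_eq_square field_simps)
  moreover have "(a - 1 / 2) * (1 - a) \<ge> 0" using a a1 by (intro mult_nonneg_nonneg) auto
  ultimately show ?thesis by linarith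
qed

lemma k_sq: "(real_of_int k)\<^sup>2 \<ge> 4"
proof -
  have "(2::real)\<^sup>2 \<le> \<bar>real_of_int k\<bar>\<^sup>2" by (rule power_mono) (use k in linarith)+
  then show ?thesis by simp
qed

text \<open>
  The problem satisfied by \<open>v\<close> in \<open>u = B v\<close>. Its potential is nonnegative by \<open>2 K\<^sup>2 / B\<^sup>2 \<le> 3 \<le> k\<^sup>2 - 1\<close>.
\<close>
lemma sturm_liouville_catenoid:
  "sturm_liouville (- cat_s0 a) (cat_s0 a) (\<lambda>s. cat_B a s ^ 3)
     (\<lambda>s. cat_B a s * ((real_of_int k)\<^sup>2 - 1 - 2 * (cat_K a)\<^sup>2 / (cat_B a s)\<^sup>2))"
proof
  note B = B_pos[OF a] and B' = B_cont[OF a]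
  have s0: "cat_s0 a > 0" using s0_spec[OF a] by simp
  show "- cat_s0 a < cat_s0 a" using s0 by simp
  show "continuous_on {- cat_s0 a..cat_s0 a} (\<lambda>s. cat_B a s ^ 3)"
    by (intro continuous_intros B')
  show "continuous_on {- cat_s0 a..cat_s0 a} (\<lambda>s. cat_B a s * ((real_of_int k)\<^sup>2 - 1 - 2 * (cat_K a)\<^sup>2 / (cat_B a s)\<^sup>2))"
    by (intro continuous_intros B') (use B in \<open>simp add: less_imp_neq[symmetric]\<close>)
  show "cat_B a s ^ 3 > 0" for s using B[of s] by simp
  show "cat_B a s * ((real_of_int k)\<^sup>2 - 1 - 2 * (cat_K a)\<^sup>2 / (cat_B a s)\<^sup>2) \<ge> 0" for s
  proof -
    have "3 * (a - 1 / 2) \<le> 3 * (cat_B a s)\<^sup>2" using B_sq_ge[OF a, of s] by (intro mult_left_mono) auto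
    then have "2 * (cat_K a)\<^sup>2 \<le> 3 * (cat_B a s)\<^sup>2" by (rule order_trans[OF potential_bound])
    then have "2 * (cat_K a)\<^sup>2 / (cat_B a s)\<^sup>2 \<le> 3" using B[of s] by (simp add: divide_le_eq)
    then show ?thesis using k_sq B[of s] by simp
  qed
  show "\<exists>s\<in>{- cat_s0 a..cat_s0 a}. cat_B a s * ((real_of_int k)\<^sup>2 - 1 - 2 * (cat_K a)\<^sup>2 / (cat_B a s)\<^sup>2) > 0"
  proof (intro bexI)
    let ?s = "cat_s0 a"
    have "(cat_B a 0)\<^sup>2 < (cat_B a ?s)\<^sup>2"
      using B_strict_mono[OF a, of 0 ?s] s0 B[of 0] by (simp add: power_strict_mono)
    then have "2 * (cat_K a)\<^sup>2 < 3 * (cat_B a ?s)\<^sup>2" using potential_bound by (simp add: B_sq[OF a])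
    then have "2 * (cat_K a)\<^sup>2 / (cat_B a ?s)\<^sup>2 < 3" using B[of ?s] by (simp add: divide_less_eq)
    then have "(real_of_int k)\<^sup>2 - 1 - 2 * (cat_K a)\<^sup>2 / (cat_B a ?s)\<^sup>2 > 0" using k_sq by linarith
    then show "cat_B a ?s * ((real_of_int k)\<^sup>2 - 1 - 2 * (cat_K a)\<^sup>2 / (cat_B a ?s)\<^sup>2) > 0"
      using B[of ?s] by (rule mult_pos_pos[rotated])
    show "?s \<in> {- cat_s0 a..cat_s0 a}" using s0 by simp
  qed
qed

text \<open>
  The function \<open>\<Phi> = B U\<close> for the symmetrised Neumann solution \<open>U\<close>. At \<open>\<plusminus> s\<^sub>0\<close> the derivative of \<open>U\<close> vanishes, so
  \<open>\<Phi>' / \<Phi> = B' / B\<close> there, which is \<open>\<plusminus> coth r\<close>.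
\<close>
lemma even_ground_state:
  obtains \<mu> \<Phi> \<Phi>' where "\<mu> > 0"
    "\<And>s. s \<in> {- cat_s0 a..cat_s0 a} \<Longrightarrow> \<Phi> s > 0"
    "\<And>s. \<Phi> (- s) = \<Phi> s"
    "\<And>s. s \<in> {- cat_s0 a..cat_s0 a} \<Longrightarrow> (\<Phi> has_real_derivative \<Phi>' s) (at s within {- cat_s0 a..cat_s0 a})"
    "\<And>s. s \<in> {- cat_s0 a..cat_s0 a} \<Longrightarrow> ((\<lambda>s. cat_B a s * \<Phi>' s) has_real_derivative
        - (cat_B a s * (cat_W a k s + \<mu>) * \<Phi> s)) (at s within {- cat_s0 a..cat_s0 a})"
    "\<Phi>' (cat_s0 a) = coth (cat_r a) * \<Phi> (cat_s0 a)"
    "\<Phi>' (- cat_s0 a) = - coth (cat_r a) * \<Phi> (- cat_s0 a)"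
proof -
  define s0 where "s0 = cat_s0 a"
  have s0: "s0 > 0" using s0_spec[OF a] by (simp add: s0_def)
  define p where "p s = cat_B a s ^ 3" for s
  define P where "P s = cat_B a s * ((real_of_int k)\<^sup>2 - 1 - 2 * (cat_K a)\<^sup>2 / (cat_B a s)\<^sup>2)" for s
  interpret sturm_liouville "- s0" s0 p P
    using sturm_liouville_catenoid by (simp add: s0_def p_def[abs_def] P_def[abs_def])
  obtain \<mu> V Z where \<mu>: "\<mu> > 0" and sol: "sol \<mu> V Z" and V: "\<And>s. s \<in> {- s0..s0} \<Longrightarrow> V s > 0"
    and Z: "Z (- s0) = 0" "Z s0 = 0"
    using neumann_ground_state by metis
  have Beven: "cat_B a (- s) = cat_B a s" for s by (simp add: cat_B_def)
  have peven: "p (- s) = p s" and Peven: "P (- s) = P s" for s by (auto simp: p_def P_def Beven)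
  define U where "U s = V s + V (- s)" for s
  define Y where "Y s = Z s - Z (- s)" for s
  have dU: "(U has_real_derivative Y s / p s) (at s within {- s0..s0})"
    and dY: "(Y has_real_derivative (P s - \<mu> * p s) * U s) (at s within {- s0..s0})" if s: "s \<in> {- s0..s0}" for s
  proof -
    have s': "- s \<in> {- s0..s0}" using s by auto
    have 1: "(V has_real_derivative Z s / p s) (at s within {- s0..s0})"
      "(Z has_real_derivative (P s - \<mu> * p s) * V s) (at s within {- s0..s0})"
      using sol s by (auto simp: sol_def)
    have "(V has_real_derivative Z (- s) / p s) (at (- s) within {- s0..s0})"
      "(Z has_real_derivative (P s - \<mu> * p s) * V (- s)) (at (- s) within {- s0..s0})"
      using sol[unfolded sol_def, rule_format, OF s'] by (simp_all add: peven Peven)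
    note 2 = this[THEN has_real_derivative_reflect]
    show "(U has_real_derivative Y s / p s) (at s within {- s0..s0})"
      unfolding U_def[abs_def] Y_def using DERIV_add[OF 1(1) 2(1)] by (simp add: diff_divide_distrib)
    show "(Y has_real_derivative (P s - \<mu> * p s) * U s) (at s within {- s0..s0})"
      unfolding Y_def[abs_def] U_def using DERIV_diff[OF 1(2) 2(2)] by (simp add: distrib_left)
  qed
  define \<Phi> where "\<Phi> s = cat_B a s * U s" for s
  define \<Phi>' where "\<Phi>' s = a * sinh (2 * s) / cat_B a s * U s + Y s / (cat_B a s)\<^sup>2" for s
  note Bp = B_pos[OF a]
  show ?thesis
  proof
    show "\<mu> > 0" by fact
    show "\<Phi> s > 0" if "s \<in> {- cat_s0 a..cat_s0 a}" for s
      using V[of s] V[of "- s"] that Bp[of s] by (auto simp: \<Phi>_def U_def s0_def intro!: mult_pos_pos add_pos_pos)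
    show "\<Phi> (- s) = \<Phi> s" for s by (simp add: \<Phi>_def U_def Beven)
    fix s assume "s \<in> {- cat_s0 a..cat_s0 a}"
    then have s: "s \<in> {- s0..s0}" by (simp add: s0_def)
    have Bnz: "cat_B a s \<noteq> 0" using Bp[of s] by simp
    have dB: "(cat_B a has_real_derivative a * sinh (2 * s) / cat_B a s) (at s within {- s0..s0})"
      by (rule B_deriv[OF a])
    have "(\<Phi> has_real_derivative \<Phi>' s) (at s within {- s0..s0})"
      unfolding \<Phi>_def[abs_def] \<Phi>'_def using Bnz
      by (auto intro!: derivative_eq_intros dB dU[OF s] simp: p_def power2_eq_square power3_eq_cube field_simps)
    then show "(\<Phi> has_real_derivative \<Phi>' s) (at s within {- cat_s0 a..cat_s0 a})" by (simp add: s0_def)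
    have flux: "(\<lambda>s. cat_B a s * \<Phi>' s) = (\<lambda>s. a * sinh (2 * s) * U s + Y s / cat_B a s)"
      using Bp by (auto simp: \<Phi>'_def fun_eq_iff field_simps power2_eq_square less_imp_neq[symmetric])
    have dG: "((\<lambda>s. a * sinh (2 * s) * U s + Y s / cat_B a s) has_real_derivative
       (a * (cosh (2 * s) * 2) * U s + a * sinh (2 * s) * (Y s / p s)
        + ((P s - \<mu> * p s) * U s * cat_B a s - Y s * (a * sinh (2 * s) / cat_B a s)) / (cat_B a s * cat_B a s)))
        (at s within {- s0..s0})"
      using Bnz by (auto intro!: derivative_eq_intros dB dU[OF s] dY[OF s])
    have c: "a * (cosh (2 * s) * 2) = 2 * (cat_B a s)\<^sup>2 + 1" by (simp add: B_sq[OF a])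
    have val: "a * (cosh (2 * s) * 2) * U s + a * sinh (2 * s) * (Y s / p s)
        + ((P s - \<mu> * p s) * U s * cat_B a s - Y s * (a * sinh (2 * s) / cat_B a s)) / (cat_B a s * cat_B a s)
        = - (cat_B a s * (cat_W a k s + \<mu>) * \<Phi> s)"
      unfolding c p_def P_def cat_W_def \<Phi>_def using Bnz
      by (simp add: field_simps power2_eq_square power3_eq_cube power4_eq_xxxx)
    show "((\<lambda>s. cat_B a s * \<Phi>' s) has_real_derivative
        - (cat_B a s * (cat_W a k s + \<mu>) * \<Phi> s)) (at s within {- cat_s0 a..cat_s0 a})"
      using dG unfolding flux val s0_def .
  next
    have Y0: "Y s0 = 0" "Y (- s0) = 0" using Z by (auto simp: Y_def)
    show "\<Phi>' (cat_s0 a) = coth (cat_r a) * \<Phi> (cat_s0 a)"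
      using Y0 Bp[of s0] unfolding coth_r[OF a] s0_def[symmetric]
      by (simp add: \<Phi>'_def \<Phi>_def power2_eq_square)
    show "\<Phi>' (- cat_s0 a) = - coth (cat_r a) * \<Phi> (- cat_s0 a)"
      using Y0 Bp[of s0] unfolding coth_r[OF a] s0_def[symmetric]
      by (simp add: \<Phi>'_def \<Phi>_def power2_eq_square Beven)
  qed
qed

lemma B_inner_pos:
  assumes u: "u \<in> H1_even a" and nz: "s \<in> {- cat_s0 a<..<cat_s0 a}" "u s \<noteq> 0"
  shows "B_inner a u u > 0"
proof -
  have uc: "continuous_on {- cat_s0 a..cat_s0 a} u" using u by (simp add: H1_even_def H1_def)
  let ?f = "\<lambda>s. cat_B a s * (u s * u s)"
  have c: "continuous_on {- cat_s0 a..cat_s0 a} ?f" by (intro continuous_intros uc B_cont[OF a])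
  have nn: "?f s \<ge> 0" for s using B_pos[OF a, of s] by simp
  have "B_inner a u u = integral {- cat_s0 a..cat_s0 a} ?f"
    unfolding B_inner_def by (rule set_integral_continuous_Ioo(2)[OF c])
  moreover have "integral {- cat_s0 a..cat_s0 a} ?f \<ge> 0"
    using nn by (intro integral_nonneg integrable_continuous_real c)
  moreover have "integral {- cat_s0 a..cat_s0 a} ?f \<noteq> 0"
    using integral_eq_0_iff[OF c] nn nz B_pos[OF a, of s] s0_spec(1)[OF a] by force
  ultimately show ?thesis by simp
qed

text \<open>
  The ground state \<open>\<Phi>\<close> is an eigenfunction by one integration by parts against the test function
  (step \<open>eigen\<close>). The Picone identity, with \<open>q = \<Phi>' / \<Phi>\<close> solving the Riccati equation
  \<open>(B q)' = - B (W + \<mu> + q\<^sup>2)\<close>, bounds the form from below (step \<open>lower\<close>); its boundary terms are those of the form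
  because \<open>q = \<plusminus> coth r\<close> at \<open>\<plusminus> s\<^sub>0\<close>. Testing an eigenfunction against itself then bounds every eigenvalue.
\<close>
proposition mu0_even_pos: "mu0_even a k > 0"
proof -
  define s0 where "s0 = cat_s0 a"
  have s0: "s0 > 0" using s0_spec[OF a] by (simp add: s0_def)
  obtain \<mu> \<Phi> \<Phi>' where \<mu>: "\<mu> > 0"
    and pos: "\<And>s. s \<in> {- s0..s0} \<Longrightarrow> \<Phi> s > 0"
    and even: "\<And>s. \<Phi> (- s) = \<Phi> s"
    and d\<Phi>: "\<And>s. s \<in> {- s0..s0} \<Longrightarrow> (\<Phi> has_real_derivative \<Phi>' s) (at s within {- s0..s0})"
    and dflux: "\<And>s. s \<in> {- s0..s0} \<Longrightarrow> ((\<lambda>s. cat_B a s * \<Phi>' s) has_real_derivative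
        - (cat_B a s * (cat_W a k s + \<mu>) * \<Phi> s)) (at s within {- s0..s0})"
    and bdry: "\<Phi>' s0 = coth (cat_r a) * \<Phi> s0" "\<Phi>' (- s0) = - coth (cat_r a) * \<Phi> (- s0)"
    by (rule even_ground_state[folded s0_def]) (rule that)
  note Bp = B_pos[OF a] and Bc = B_cont[OF a]
  have Bnz: "cat_B a s \<noteq> 0" for s using Bp[of s] by simp
  have Beven: "cat_B a (- s) = cat_B a s" for s by (simp add: cat_B_def)
  have Wc: "continuous_on S (cat_W a k)" for S
    unfolding cat_W_def[abs_def] using Bnz by (intro continuous_intros Bc) auto
  have \<Phi>c: "continuous_on {- s0..s0} \<Phi>" by (rule DERIV_continuous_on[OF d\<Phi>])
  have fluxc: "continuous_on {- s0..s0} (\<lambda>s. cat_B a s * \<Phi>' s)" by (rule DERIV_continuous_on[OF dflux])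
  have "continuous_on {- s0..s0} (\<lambda>s. cat_B a s * \<Phi>' s / cat_B a s)"
    using Bnz by (intro continuous_intros fluxc Bc) auto
  then have \<Phi>'c: "continuous_on {- s0..s0} \<Phi>'" using Bnz by simp
  have flux': "continuous_on {- s0..s0} (\<lambda>s. - (cat_B a s * (cat_W a k s + \<mu>) * \<Phi> s))"
    by (intro continuous_intros Bc Wc \<Phi>c)
  have prim\<Phi>: "primitive_on (- s0) s0 \<Phi> \<Phi>'"
    by (rule primitive_on_C1[OF \<Phi>'c d\<Phi>])
  have prim_flux: "primitive_on (- s0) s0 (\<lambda>s. cat_B a s * \<Phi>' s) (\<lambda>s. - (cat_B a s * (cat_W a k s + \<mu>) * \<Phi> s))"
    by (rule primitive_on_C1[OF flux' dflux])
  have \<Phi>H: "\<Phi> \<in> H1 (- s0) s0"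
    using primitive_on_H1[OF prim\<Phi> L2_continuous[OF \<Phi>'c]] s0 by simp
  then have \<Phi>E: "\<Phi> \<in> H1_even a" using even by (simp add: H1_even_def s0_def)
  have weak: "weak_deriv (- s0) s0 u \<in> L2 (- s0) s0" "primitive_on (- s0) s0 u (weak_deriv (- s0) s0 u)"
    "continuous_on {- s0..s0} u" if "u \<in> H1_even a" for u
    using H1_weak_deriv[of u "- s0" s0] that s0 by (auto simp: H1_even_def s0_def H1_def)
  have int_form: "set_integrable lborel {- s0<..<s0}
      (\<lambda>s. cat_B a s * (u' s * w' s) - cat_B a s * cat_W a k s * (u s * w s))"
    if "u' \<in> L2 (- s0) s0" "w' \<in> L2 (- s0) s0" "continuous_on {- s0..s0} u" "continuous_on {- s0..s0} w" for u w u' w'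
  proof (rule set_integral_diff)
    show "set_integrable lborel {- s0<..<s0} (\<lambda>s. cat_B a s * (u' s * w' s))"
      by (intro set_integrable_continuous_mult Bc L2_mult_integrable that)
    show "set_integrable lborel {- s0<..<s0} (\<lambda>s. cat_B a s * cat_W a k s * (u s * w s))"
      by (intro set_integral_continuous_Ioo(1) continuous_intros Bc Wc that)
  qed
  have int_B: "set_integrable lborel {- s0<..<s0} (\<lambda>s. cat_B a s * (u s * w s))"
    if "continuous_on {- s0..s0} u" "continuous_on {- s0..s0} w" for u w
    by (intro set_integral_continuous_Ioo(1) continuous_intros Bc that)
  have eigen: "S_rad a k \<Phi> w = \<mu> * B_inner a \<Phi> w" if w: "w \<in> H1_even a" for w
  proof -
    let ?v = "weak_deriv (- s0) s0 \<Phi>" and ?w = "weak_deriv (- s0) s0 w"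
    note W = weak[OF w]
    let ?F = "\<lambda>s. cat_B a s * (\<Phi>' s * ?w s) - cat_B a s * cat_W a k s * (\<Phi> s * w s)"
    let ?G = "\<lambda>s. cat_B a s * (?v s * ?w s) - cat_B a s * cat_W a k s * (\<Phi> s * w s)"
    have iF: "set_integrable lborel {- s0<..<s0} ?F"
      by (rule int_form[OF L2_continuous[OF \<Phi>'c] W(1) \<Phi>c W(3)])
    have iG: "set_integrable lborel {- s0<..<s0} ?G"
      by (rule int_form[OF weak(1)[OF \<Phi>E] W(1) \<Phi>c W(3)])
    have "AE s in lborel. indicator {- s0<..<s0} s *\<^sub>R ?v s = indicator {- s0<..<s0} s *\<^sub>R \<Phi>' s"
      by (rule primitive_on_unique_AE[OF weak(2)[OF \<Phi>E] prim\<Phi>]) (use s0 in simp)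
    then have "AE s in lborel. indicator {- s0<..<s0} s *\<^sub>R ?G s = indicator {- s0<..<s0} s *\<^sub>R ?F s"
      by eventually_elim (auto simp: indicator_def)
    then have GF: "(LBINT s:{- s0<..<s0}. ?G s) = (LBINT s:{- s0<..<s0}. ?F s)"
      unfolding set_lebesgue_integral_def using iF iG
      by (intro integral_cong_AE) (auto simp: set_integrable_def dest: borel_measurable_integrable)
    have "cat_B a s0 * \<Phi>' s0 * w s0 - cat_B a (- s0) * \<Phi>' (- s0) * w (- s0)
      = (LBINT s:{- s0<..<s0}. cat_B a s * \<Phi>' s * ?w s + - (cat_B a s * (cat_W a k s + \<mu>) * \<Phi> s) * w s)"
      using primitive_on_mult_endpoints[OF prim_flux W(2)] s0 by simp
    also have "\<dots> = (LBINT s:{- s0<..<s0}. ?F s - \<mu> * (cat_B a s * (\<Phi> s * w s)))"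
      by (intro set_lebesgue_integral_cong) (auto simp: algebra_simps)
    also have "\<dots> = (LBINT s:{- s0<..<s0}. ?F s) - \<mu> * B_inner a \<Phi> w"
      using iF int_B[OF \<Phi>c W(3)] by (simp add: B_inner_def s0_def[symmetric])
    finally have "(LBINT s:{- s0<..<s0}. ?F s) - \<mu> * B_inner a \<Phi> w
        = coth (cat_r a) * cat_B a s0 * (\<Phi> s0 * w s0 + \<Phi> (- s0) * w (- s0))"
      by (simp add: bdry Beven algebra_simps)
    then show ?thesis
      unfolding S_rad_def Let_def s0_def[symmetric] GF by simp
  qed
  have lower: "S_rad a k w w \<ge> \<mu> * B_inner a w w" if w: "w \<in> H1_even a" for w
  proof -
    let ?w = "weak_deriv (- s0) s0 w"
    note W = weak[OF w]
    define q where "q s = \<Phi>' s / \<Phi> s" for s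
    have nz: "\<Phi> s \<noteq> 0" if "s \<in> {- s0..s0}" for s using pos[OF that] by simp
    have qc: "continuous_on {- s0..s0} q"
      unfolding q_def using nz by (intro continuous_intros \<Phi>'c \<Phi>c) auto
    have dq: "((\<lambda>s. cat_B a s * q s) has_real_derivative - cat_B a s * (cat_W a k s + \<mu> + (q s)\<^sup>2)) (at s within {- s0..s0})"
      if s: "s \<in> {- s0..s0}" for s
    proof -
      have "((\<lambda>s. cat_B a s * \<Phi>' s / \<Phi> s) has_real_derivative
        (- (cat_B a s * (cat_W a k s + \<mu>) * \<Phi> s) * \<Phi> s - cat_B a s * \<Phi>' s * \<Phi>' s) / (\<Phi> s * \<Phi> s)) (at s within {- s0..s0})"
        by (rule DERIV_divide[OF dflux[OF s] d\<Phi>[OF s] nz[OF s]])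
      moreover have "(- (cat_B a s * (cat_W a k s + \<mu>) * \<Phi> s) * \<Phi> s - cat_B a s * \<Phi>' s * \<Phi>' s) / (\<Phi> s * \<Phi> s)
        = - cat_B a s * (cat_W a k s + \<mu> + (q s)\<^sup>2)"
        using nz[OF s] by (simp add: q_def field_simps power2_eq_square)
      ultimately show ?thesis by (simp add: q_def)
    qed
    have "primitive_on (- s0) s0 (\<lambda>s. cat_B a s * q s) (\<lambda>s. - cat_B a s * (cat_W a k s + \<mu> + (q s)\<^sup>2))"
      by (rule primitive_on_C1[OF _ dq]) (intro continuous_intros Bc Wc qc)
    note P = primitive_on_mult[OF this primitive_on_mult[OF W(2) W(2)]]
    let ?F = "\<lambda>s. cat_B a s * (?w s * ?w s) - cat_B a s * cat_W a k s * (w s * w s)"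
    let ?G = "\<lambda>s. cat_B a s * q s * (w s * ?w s + ?w s * w s) + - cat_B a s * (cat_W a k s + \<mu> + (q s)\<^sup>2) * (w s * w s)"
    have iF: "set_integrable lborel {- s0<..<s0} ?F" by (rule int_form[OF W(1) W(1) W(3) W(3)])
    have iB: "set_integrable lborel {- s0<..<s0} (\<lambda>s. \<mu> * (cat_B a s * (w s * w s)))"
      using int_B[OF W(3) W(3)] by simp
    have iG: "set_integrable lborel {- s0<..<s0} ?G" using P by (simp add: primitive_on_def)
    \<comment> \<open>The total derivative of \<open>B q w\<^sup>2\<close> carries the boundary terms of the form.\<close>
    have "(LBINT s:{- s0<..<s0}. ?G s) = cat_B a s0 * q s0 * (w s0 * w s0) - cat_B a (- s0) * q (- s0) * (w (- s0) * w (- s0))"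
      using primitive_on_diff[OF P, of "- s0" s0] s0 by simp
    also have "\<dots> = coth (cat_r a) * cat_B a s0 * (w s0 * w s0 + w (- s0) * w (- s0))"
      using nz[of s0] nz[of "- s0"] s0 by (simp add: q_def bdry Beven algebra_simps)
    finally have S: "S_rad a k w w = (LBINT s:{- s0<..<s0}. ?F s) - (LBINT s:{- s0<..<s0}. ?G s)"
      unfolding S_rad_def Let_def s0_def[symmetric] by simp
    have "(LBINT s:{- s0<..<s0}. cat_B a s * (?w s - q s * w s)\<^sup>2)
        = (LBINT s:{- s0<..<s0}. ?F s - ?G s - \<mu> * (cat_B a s * (w s * w s)))"
      by (intro set_lebesgue_integral_cong) (auto simp: algebra_simps power2_eq_square)
    also have "\<dots> = S_rad a k w w - \<mu> * B_inner a w w"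
      using iF iG int_B[OF W(3) W(3)] by (simp add: S B_inner_def s0_def[symmetric])
    finally have "S_rad a k w w - \<mu> * B_inner a w w
      = (LBINT s:{- s0<..<s0}. cat_B a s * (?w s - q s * w s)\<^sup>2)" by simp
    moreover have "\<dots> \<ge> 0"
      unfolding set_lebesgue_integral_def using Bp
      by (intro Bochner_Integration.integral_nonneg) (auto simp: indicator_def less_imp_le)
    ultimately show ?thesis by simp
  qed
  have "mu0_even a k = \<mu>"
    unfolding mu0_even_def
  proof (rule Least_equality)
    have "\<Phi> 0 \<noteq> 0" using pos[of 0] s0 by simp
    then show "is_even_eigenvalue a k \<mu>"
      unfolding is_even_eigenvalue_def using \<Phi>E eigen s0 s0_def by (intro bexI[of _ \<Phi>]) auto
    fix \<nu> assume "is_even_eigenvalue a k \<nu>"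
    then obtain u s where u: "u \<in> H1_even a" "s \<in> {- cat_s0 a<..<cat_s0 a}" "u s \<noteq> 0"
      and e: "S_rad a k u u = \<nu> * B_inner a u u"
      unfolding is_even_eigenvalue_def by blast
    have "\<mu> * B_inner a u u \<le> \<nu> * B_inner a u u" using lower[OF u(1)] e by simp
    then show "\<mu> \<le> \<nu>" using B_inner_pos[OF u] by simp
  qed
  then show ?thesis using \<mu> by simp
qed

end

theorem theorem9p5:
  shows "(\<forall>a::real. 1 / 2 < a \<and> a \<le> 1 \<longrightarrow> mu0_even a 2 > 0) \<and>
         (\<forall>a::real. 1 / 2 < a \<and> a \<le> 1 \<longrightarrow> (\<forall>k::int. \<bar>k\<bar> \<ge> 2 \<longrightarrow> mu0_even a k > 0))"
  using mu0_even_pos by simp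

end
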